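(* Let $t$ be a positive integer with $t\equiv 0\pmod 4$. Then $$\mathrm{ex}^*(n,B_{t,3})\le\frac{t}{2}n+O(1).$$
   Context: All graphs are finite and simple. An edge-coloring of a graph is a function $c:E(G)\to\mathbb{N}$; it is proper if incident edges receive different colors. A subgraph is rainbow under $c$ if its edges have pairwise distinct colors. A graph $G$ is rainbow-$F$-free if it admits a proper edge-coloring under which no (not necessarily induced) copy of $F$ in $G$ is rainbow. The rainbow Turán number $\mathrm{ex}^*(n,F)$ is the maximum number of edges in an $n$-vertex rainbow-$F$-free graph. For $t\ge 3$, $B_{t,3}$ is the broom with $t$ edges and handle length $3$: the tree obtained from a path with $3$ edges (the handle) by adding $t-3$ pendant edges (the bristles) at one end vertex of the path. Here $O(1)$ is a quantity bounded by a constant depending only on $t$, as $n\to\infty$. *)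

theory Defs
  imports Complex_Main
begin

record 'a ugraph =
  verts :: "'a set"
  edges :: "'a set set"

definition simple_graph :: "'a ugraph \<Rightarrow> bool" where
  "simple_graph G \<longleftrightarrow>
     finite (verts G) \<and> (\<forall>e\<in>edges G. e \<subseteq> verts G \<and> card e = 2)"

definition subgraph :: "'a ugraph \<Rightarrow> 'a ugraph \<Rightarrow> bool" where
  "subgraph H G \<longleftrightarrow>
     simple_graph H \<and> verts H \<subseteq> verts G \<and> edges H \<subseteq> edges G"

definition isomorphic :: "'a ugraph \<Rightarrow> 'b ugraph \<Rightarrow> bool" where
  "isomorphic F H \<longleftrightarrow>
     (\<exists>f. bij_betw f (verts F) (verts H) \<and> edges H = (\<lambda>e. f ` e) ` edges F)"

definition is_copy :: "'b ugraph \<Rightarrow> 'a ugraph \<Rightarrow> 'a ugraph \<Rightarrow> bool" where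
  "is_copy F G H \<longleftrightarrow> subgraph H G \<and> isomorphic F H"

(* A colouring is a total function on vertex sets; only its values on edges matter. *)

definition proper_edge_coloring :: "'a ugraph \<Rightarrow> ('a set \<Rightarrow> nat) \<Rightarrow> bool" where
  "proper_edge_coloring G c \<longleftrightarrow>
     (\<forall>e\<in>edges G. \<forall>e'\<in>edges G. e \<noteq> e' \<and> e \<inter> e' \<noteq> {} \<longrightarrow> c e \<noteq> c e')"

definition rainbow :: "('a set \<Rightarrow> nat) \<Rightarrow> 'a ugraph \<Rightarrow> bool" where
  "rainbow c H \<longleftrightarrow> inj_on c (edges H)"

definition rainbow_free :: "'b ugraph \<Rightarrow> 'a ugraph \<Rightarrow> bool" where
  "rainbow_free F G \<longleftrightarrow>
     (\<exists>c. proper_edge_coloring G c \<and> \<not> (\<exists>H. is_copy F G H \<and> rainbow c H))"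

(* Up to isomorphism every finite graph has its vertices in nat. If F has no edges the
   set below can be empty, and then Max is unspecified; for F with at least one edge see
   ex_star_well_defined. *)

definition ex_star :: "nat \<Rightarrow> 'b ugraph \<Rightarrow> nat" where
  "ex_star n F =
     Max {card (edges G) | G :: nat ugraph.
            simple_graph G \<and> card (verts G) = n \<and> rainbow_free F G}"

(* The broom with t edges and handle length l, meant for l \<le> t: the handle is the path
   0, 1, ..., l, and the t - l bristles join its end vertex l to l + 1, ..., t. *)

definition broom :: "nat \<Rightarrow> nat \<Rightarrow> nat ugraph" where
  "broom t l = \<lparr> verts = {0..t},
                 edges = {{i, i + 1} | i. i < l} \<union> {{l, j} | j. l < j \<and> j \<le> t} \<rparr>"

lemma ex_star_well_defined:
  fixes F :: "'b ugraph" and n :: nat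
  assumes "edges F \<noteq> {}"
  defines "S \<equiv> {card (edges G) | G :: nat ugraph.
                 simple_graph G \<and> card (verts G) = n \<and> rainbow_free F G}"
  shows "finite S" and "S \<noteq> {}"
proof -
  have "card (edges G) \<le> 2 ^ n" if "simple_graph G" "card (verts G) = n" for G :: "nat ugraph"
  proof -
    have "edges G \<subseteq> Pow (verts G)" "finite (verts G)"
      using that by (auto simp: simple_graph_def)
    then show ?thesis
      using card_mono[of "Pow (verts G)" "edges G"] that by (simp add: card_Pow)
  qed
  then have "S \<subseteq> {..2 ^ n}" by (auto simp: S_def)
  then show "finite S" by (rule finite_subset) simp
  let ?G = "\<lparr> verts = {..<n}, edges = {} \<rparr> :: nat ugraph"
  have "rainbow_free F ?G"
    using assms(1)
    by (auto simp: rainbow_free_def proper_edge_coloring_def is_copy_def subgraph_def isomorphic_def)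
  moreover have "simple_graph ?G" "card (verts ?G) = n"
    by (auto simp: simple_graph_def)
  ultimately show "S \<noteq> {}" unfolding S_def by blast
qed

lemma broom_simple_graph: "l \<le> t \<Longrightarrow> simple_graph (broom t l)"
  by (auto simp: simple_graph_def broom_def card_insert_if)

lemma card_edges_broom:
  assumes "l \<le> t"
  shows "card (edges (broom t l)) = t"
proof -
  let ?A = "(\<lambda>i. {i, i + 1}) ` {..<l}" and ?B = "(\<lambda>j. {l, j}) ` {l<..t}"
  have "edges (broom t l) = ?A \<union> ?B"
    by (auto simp: broom_def)
  moreover have "card ?A = l"
    by (subst card_image) (auto simp: inj_on_def doubleton_eq_iff)
  moreover have "card ?B = t - l"
    by (subst card_image) (auto simp: inj_on_def doubleton_eq_iff)
  moreover have "?A \<inter> ?B = {}"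
    by (auto simp: doubleton_eq_iff)
  ultimately show ?thesis
    using assms by (simp add: card_Un_disjoint)
qed

end

theory Submission
  imports Defs
begin

text \<open>
  The bound holds with constant 0. Deleting sparse vertex sets, one may assume that every vertex has
  degree more than \<open>t/2\<close> and that no component is too sparse. A vertex \<open>v\<close> of degree at least
  \<open>t + 1\<close> then has degree exactly \<open>t + 1\<close>: for a rainbow path \<open>v a b d\<close>, the bristles at \<open>v\<close> must
  avoid the vertices \<open>a, b, d\<close> and the colours of \<open>ab\<close> and \<open>bd\<close>, which excludes at most five
  neighbours of \<open>v\<close>, and all five exclusions are needed. Hence the component of \<open>v\<close> is a complete graph on
  \<open>t + 2\<close> vertices minus at most \<open>t/2\<close> edges, all colours occur at every vertex \<open>u\<close> joined to
  all others, and for such \<open>u\<close> the equality \<open>col a b = col u c\<close> forces \<open>col b c = col u a\<close>.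

  If no edge were missing, any two colour classes would form 4-cycles, so 4 would divide \<open>t + 2\<close>.
  In general, two universal vertices \<open>v, w\<close> split the other vertices into an even number \<open>t/2\<close> of
  pairs \<open>{y, tau y}\<close> with \<open>col w (tau y) = col v y\<close>. Ideally the two colours that \<open>v\<close> sends to a
  pair \<open>P\<close> match up the remaining pairs, whose number \<open>t/2 - 1\<close> is odd. So each \<open>P\<close> forces defects:
  missing colours, missing edges between pairs that its colours join, or missing edges at \<open>P\<close>.
  Every missing edge is shared by few \<open>P\<close>, and weighing the defects contradicts the bound \<open>t/2\<close> on
  the number of missing edges.
\<close>

section \<open>Defects of multigraphs with an odd number of vertices\<close>

text \<open>The orbits of an involution without fixed points partition \<open>A\<close> into
  two-element sets. Applied to the swap of ordered pairs, this also yields the handshake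
  counts.\<close>

lemma card_involution_pairs:
  assumes "finite A" and f: "\<And>a. a \<in> A \<Longrightarrow> f a \<in> A \<and> f a \<noteq> a \<and> f (f a) = a"
  shows "2 * card ((\<lambda>a. {a, f a}) ` A) = card A"
proof -
  have U: "\<Union> ((\<lambda>a. {a, f a}) ` A) = A" using f by auto
  have "2 * card ((\<lambda>a. {a, f a}) ` A) = card (\<Union> ((\<lambda>a. {a, f a}) ` A))"
  proof (rule card_partition)
    show "finite ((\<lambda>a. {a, f a}) ` A)" "finite (\<Union> ((\<lambda>a. {a, f a}) ` A))"
      using assms(1) by auto
    show "card c = 2" if "c \<in> (\<lambda>a. {a, f a}) ` A" for c
      using that f by (force simp: card_2_iff)
    show "c1 \<inter> c2 = {}"
      if c: "c1 \<in> (\<lambda>a. {a, f a}) ` A" "c2 \<in> (\<lambda>a. {a, f a}) ` A" "c1 \<noteq> c2" for c1 c2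
    proof -
      obtain a b where ab: "a \<in> A" "b \<in> A" "c1 = {a, f a}" "c2 = {b, f b}" using c(1,2) by auto
      have "a \<noteq> b" "f a \<noteq> b" "a \<noteq> f b" using ab c(3) f[of a] f[of b] by auto
      moreover from this have "f a \<noteq> f b" using f[of a] f[of b] ab by metis
      ultimately show ?thesis using ab by auto
    qed
  qed
  then show ?thesis using U by simp
qed

text \<open>Intended: \<open>K\<close> consists of the pairs other than a fixed \<open>P\<close>,
  \<open>n Q R\<close> counts the edges between \<open>Q\<close> and \<open>R\<close> in the two
  colours of \<open>P\<close>, and \<open>d Q\<close> counts colours missing at \<open>Q\<close>.
  With no defects, the multiplicities 4 would form a perfect matching on an odd set.\<close>

locale odd_multigraph =
  fixes K :: "'b set" and n :: "'b \<Rightarrow> 'b \<Rightarrow> nat" and d :: "'b \<Rightarrow> nat" and bad :: "'b \<Rightarrow> 'b \<Rightarrow> bool"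
  assumes finite_K: "finite K" and odd_K: "odd (card K)"
    and n_sym: "n Q R = n R Q" and n_irrefl: "Q \<in> K \<Longrightarrow> n Q Q = 0"
    and degree: "Q \<in> K \<Longrightarrow> (\<Sum>R\<in>K. n Q R) + d Q = 4"
    and bad_sym: "bad Q R \<Longrightarrow> bad R Q"
begin

definition nbrs :: "'b \<Rightarrow> 'b set" where
  "nbrs Q = {R \<in> K. \<not> bad Q R \<and> n Q R > 0}"

definition cost :: "'b \<Rightarrow> nat" where
  "cost Q = (\<Sum>R\<in>nbrs Q. 4 - n Q R)"

definition bad_degree :: "'b \<Rightarrow> nat" where
  "bad_degree Q = (\<Sum>R\<in>{R \<in> K. bad Q R}. n Q R)"

definition unmatched :: "'b set" where
  "unmatched = {Q \<in> K. \<forall>R\<in>nbrs Q. n Q R \<noteq> 4}"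

lemma finite_unmatched: "finite unmatched"
  using finite_K by (simp add: unmatched_def)

lemma degree_split:
  assumes "Q \<in> K"
  shows "(\<Sum>R\<in>nbrs Q. n Q R) + bad_degree Q + d Q = 4"
proof -
  have "(\<Sum>R\<in>K. n Q R) = (\<Sum>R\<in>{R \<in> K. bad Q R}. n Q R) + (\<Sum>R\<in>{R \<in> K. \<not> bad Q R}. n Q R)"
    by (subst sum.union_disjoint[symmetric]) (auto simp: finite_K intro: sum.cong)
  also have "(\<Sum>R\<in>{R \<in> K. \<not> bad Q R}. n Q R) = (\<Sum>R\<in>nbrs Q. n Q R)"
    by (rule sum.mono_neutral_right) (auto simp: finite_K nbrs_def)
  finally show ?thesis using degree[OF assms] by (simp add: bad_degree_def)
qed

lemma n_le_4: "Q \<in> K \<Longrightarrow> R \<in> K \<Longrightarrow> n Q R \<le> 4"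
  using degree[of Q] member_le_sum[of R K "n Q"] finite_K by auto

lemma n_4_unique:
  assumes "Q \<in> K" "R \<in> K" "n Q R = 4" "S \<in> K" "n Q S > 0"
  shows "S = R"
proof (rule ccontr)
  assume "S \<noteq> R"
  then have "n Q R + n Q S = (\<Sum>T\<in>{R, S}. n Q T)" by simp
  also have "\<dots> \<le> (\<Sum>T\<in>K. n Q T)" using assms finite_K by (intro sum_mono2) auto
  finally show False using degree[OF assms(1)] assms by simp
qed

lemma cost_eq:
  assumes "Q \<in> K"
  shows "cost Q + 4 = 4 * card (nbrs Q) + d Q + bad_degree Q"
proof -
  have "cost Q + (\<Sum>R\<in>nbrs Q. n Q R) = (\<Sum>R\<in>nbrs Q. 4)"
    unfolding cost_def sum.distrib[symmetric]
    using n_le_4[OF assms] by (intro sum.cong) (auto simp: nbrs_def)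
  then show ?thesis using degree_split[OF assms] by simp
qed

lemma term_bound_bad:
  assumes "Q \<in> K" "bad_degree Q \<le> 3"
  shows "bad_degree Q \<le> 3 * d Q + cost Q"
proof (cases "nbrs Q = {}")
  case True
  then show ?thesis using degree_split[OF assms(1)] assms(2) by simp
next
  case False
  then have "card (nbrs Q) \<ge> 1" using finite_K by (simp add: nbrs_def card_gt_0_iff Suc_le_eq)
  then show ?thesis using cost_eq[OF assms(1)] by simp
qed

text \<open>Without neighbours, \<open>d Q = 4\<close>. With one neighbour of multiplicity
  \<open>m < 4\<close>, both \<open>d Q\<close> and the cost equal \<open>4 - m\<close>. With two or
  more neighbours the cost alone is at least 4.\<close>

lemma term_bound_unmatched:
  assumes "Q \<in> unmatched" "bad_degree Q = 0"
  shows "4 \<le> 3 * d Q + cost Q"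
proof -
  have Q: "Q \<in> K" using assms by (simp add: unmatched_def)
  consider "nbrs Q = {}" | R where "nbrs Q = {R}" | "card (nbrs Q) \<ge> 2"
  proof -
    have "finite (nbrs Q)" using finite_K by (simp add: nbrs_def)
    then have "nbrs Q = {} \<or> card (nbrs Q) = 1 \<or> card (nbrs Q) \<ge> 2"
      using card_0_eq[of "nbrs Q"] by linarith
    then show ?thesis using that by (auto simp: card_1_singleton_iff)
  qed
  then show ?thesis
  proof cases
    case 1
    then show ?thesis using degree_split[OF Q] assms by simp
  next
    case (2 R)
    then have "n Q R \<noteq> 4" using assms(1) by (simp add: unmatched_def)
    then have "d Q \<noteq> 0" using degree_split[OF Q] 2 assms(2) by auto
    then show ?thesis using cost_eq[OF Q] 2 assms by simp
  next
    case 3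
    then show ?thesis using cost_eq[OF Q] by simp
  qed
qed

lemma term_bound_isolated:
  assumes "Q \<in> K" "nbrs Q = {}" "bad_degree Q = 0"
  shows "3 * d Q + cost Q \<ge> 12"
  using degree_split[OF assms(1)] assms by simp

text \<open>Multiplicity 4 uses up the whole degree, so a matched vertex has no neighbour besides
  its partner.\<close>

lemma nbr_of_unmatched:
  assumes "Q \<in> unmatched" "R \<in> nbrs Q"
  shows "R \<in> unmatched"
proof (rule ccontr)
  assume "R \<notin> unmatched"
  then obtain S where S: "S \<in> nbrs R" "n R S = 4" "S \<in> K" "R \<in> K"
    using assms by (auto simp: unmatched_def nbrs_def)
  have "Q = S"
    using n_4_unique[of R S Q] S assms n_sym[of Q R] by (auto simp: unmatched_def nbrs_def)
  then show False using S assms n_sym[of Q R] by (auto simp: unmatched_def)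
qed

lemma bad_nbr_unmatched:
  assumes "Q \<in> K" "R \<in> K" "bad Q R" "n Q R > 0"
  shows "R \<in> unmatched"
proof (rule ccontr)
  assume "R \<notin> unmatched"
  then obtain S where S: "S \<in> nbrs R" "n R S = 4" "S \<in> K"
    using assms by (auto simp: unmatched_def nbrs_def)
  then have "Q = S"
    using n_4_unique[of R S Q] assms n_sym[of Q R] by auto
  then show False using S assms bad_sym by (auto simp: nbrs_def)
qed

lemma odd_unmatched: "odd (card unmatched)"
proof -
  define A where "A = K - unmatched"
  define f where "f Q = (SOME R. R \<in> nbrs Q \<and> n Q R = 4)" for Q
  have f: "f Q \<in> nbrs Q \<and> n Q (f Q) = 4" if "Q \<in> A" for Q
    unfolding f_def
    by (rule someI_ex) (use that in \<open>auto simp: A_def unmatched_def\<close>)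
  have "2 * card ((\<lambda>Q. {Q, f Q}) ` A) = card A"
  proof (rule card_involution_pairs)
    show "finite A" using finite_K by (simp add: A_def)
    fix Q assume Q: "Q \<in> A"
    have *: "f Q \<in> K" "Q \<in> K" "n (f Q) Q = 4" "Q \<in> nbrs (f Q)"
      using f[OF Q] Q n_sym[of Q "f Q"] bad_sym by (auto simp: nbrs_def A_def)
    then have A: "f Q \<in> A" by (auto simp: A_def unmatched_def)
    moreover have "f Q \<noteq> Q" using * n_irrefl[of Q] by auto
    moreover have "f (f Q) = Q"
      using n_4_unique[of "f Q" Q "f (f Q)"] * f[OF A] by (auto simp: nbrs_def)
    ultimately show "f Q \<in> A \<and> f Q \<noteq> Q \<and> f (f Q) = Q" by simp
  qed
  then have "even (card A)" by (metis dvd_triv_left)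
  moreover have "card K = card unmatched + card A"
    unfolding A_def using finite_K card_mono[of K unmatched] 
    by (subst card_Diff_subset) (auto simp: unmatched_def)
  ultimately show ?thesis using odd_K by simp
qed

text \<open>The set \<open>unmatched\<close> has odd size. If it has one element, that vertex has no
  neighbours, so \<open>d = 4\<close> and it pays \<open>3 * 4\<close>. Otherwise at least three
  vertices pay 4 each.\<close>

lemma sum_ge_12:
  assumes "\<And>Q R. Q \<in> K \<Longrightarrow> R \<in> K \<Longrightarrow> Q \<noteq> R \<Longrightarrow> \<not> bad Q R"
  shows "12 \<le> (\<Sum>Q\<in>K. 3 * d Q + cost Q)"
proof -
  have b0: "bad_degree Q = 0" if "Q \<in> K" for Q
    unfolding bad_degree_def
    by (rule sum.neutral) (use assms that n_irrefl in \<open>metis (mono_tags) mem_Collect_eq\<close>)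
  have UK: "unmatched \<subseteq> K" by (auto simp: unmatched_def)
  then have le: "(\<Sum>Q\<in>unmatched. 3 * d Q + cost Q) \<le> (\<Sum>Q\<in>K. 3 * d Q + cost Q)"
    using finite_K by (intro sum_mono2) auto
  show ?thesis
  proof (cases "card unmatched = 1")
    case True
    then obtain Q where Q: "unmatched = {Q}" by (auto simp: card_1_singleton_iff)
    have "nbrs Q = {}" using nbr_of_unmatched[of Q] Q n_irrefl by (fastforce simp: nbrs_def)
    then show ?thesis using term_bound_isolated[of Q] Q UK b0[of Q] le by auto
  next
    case False
    then have "card unmatched \<ge> 3" using odd_unmatched
      by (metis One_nat_def Suc_leI even_numeral le_neq_implies_less not_less_eq_eq numeral_2_eq_2
          numeral_3_eq_3 odd_pos)
    moreover have "(\<Sum>Q\<in>unmatched. 4) \<le> (\<Sum>Q\<in>unmatched. 3 * d Q + cost Q)"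
      using UK b0 by (intro sum_mono term_bound_unmatched) auto
    ultimately show ?thesis using le by simp
  qed
qed

text \<open>Either some unmatched vertex has bad degree 0 and pays 4 alone, or the bad edges at
  unmatched vertices form a star with centre \<open>Q0\<close>. Then centre and leaves have the same
  total bad degree, and \<open>term_bound_bad\<close> is used on both sides.\<close>

lemma sum_ge_4:
  assumes Q0: "\<And>Q R. Q \<in> K \<Longrightarrow> R \<in> K \<Longrightarrow> Q \<noteq> R \<Longrightarrow> bad Q R \<Longrightarrow> Q = Q0 \<or> R = Q0"
  shows "4 \<le> (\<Sum>Q\<in>K. 3 * d Q + cost Q)"
proof -
  let ?f = "\<lambda>Q. 3 * d Q + cost Q"
  have UK: "unmatched \<subseteq> K" by (auto simp: unmatched_def)
  then have le: "sum ?f unmatched \<le> sum ?f K"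
    using finite_K by (intro sum_mono2) auto
  show ?thesis
  proof (cases "\<exists>Q\<in>unmatched. bad_degree Q = 0")
    case True
    then obtain Q where "Q \<in> unmatched" "bad_degree Q = 0" by blast
    then show ?thesis
      using term_bound_unmatched[of Q] member_le_sum[of Q unmatched ?f] le finite_unmatched by simp
  next
    case False
    define B where "B = unmatched - {Q0}"
    have single: "bad_degree Q = n Q0 Q \<and> bad Q0 Q \<and> Q0 \<in> K" if "Q \<in> B" for Q
    proof -
      have "{R \<in> K. bad Q R \<and> n Q R \<noteq> 0} \<subseteq> {Q0}"
      proof
        fix R assume R: "R \<in> {R \<in> K. bad Q R \<and> n Q R \<noteq> 0}"
        then have "Q \<noteq> R" using n_irrefl[of Q] that UK by (auto simp: B_def)
        then show "R \<in> {Q0}" using Q0[of Q R] R that UK by (auto simp: B_def)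
      qed
      moreover have "bad_degree Q = (\<Sum>R\<in>{R \<in> K. bad Q R \<and> n Q R \<noteq> 0}. n Q R)"
        unfolding bad_degree_def using finite_K by (intro sum.mono_neutral_right) auto
      moreover have "bad_degree Q \<noteq> 0" using False that by (auto simp: B_def)
      ultimately have "{R \<in> K. bad Q R \<and> n Q R \<noteq> 0} = {Q0}"
        by (metis (no_types, lifting) subset_singletonD sum.empty)
      then show ?thesis using \<open>bad_degree Q = _\<close> n_sym[of Q Q0] bad_sym[of Q Q0] by auto
    qed
    have "unmatched \<noteq> {}" using odd_unmatched by auto
    have Q0U: "Q0 \<in> unmatched"
    proof (rule ccontr)
      assume "Q0 \<notin> unmatched"
      then obtain Q where Q: "Q \<in> B" using \<open>unmatched \<noteq> {}\<close> by (auto simp: B_def)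
      then have "n Q Q0 > 0" using single[OF Q] False n_sym[of Q Q0] by (auto simp: B_def)
      then show False using bad_nbr_unmatched[of Q Q0] single[OF Q] Q UK bad_sym \<open>Q0 \<notin> unmatched\<close>
        by (auto simp: B_def)
    qed
    have sumB: "bad_degree Q0 = (\<Sum>Q\<in>B. bad_degree Q)"
    proof -
      have "bad_degree Q0 = (\<Sum>Q\<in>B. n Q0 Q)"
        unfolding bad_degree_def
      proof (rule sum.mono_neutral_right)
        show "finite {R \<in> K. bad Q0 R}" using finite_K by simp
        show "B \<subseteq> {R \<in> K. bad Q0 R}" using single UK by (auto simp: B_def)
        show "\<forall>R\<in>{R \<in> K. bad Q0 R} - B. n Q0 R = 0"
          using bad_nbr_unmatched[of Q0] Q0U UK n_irrefl by (force simp: B_def)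
      qed
      then show ?thesis using single by simp
    qed
    have pos: "bad_degree Q \<ge> 1" if "Q \<in> unmatched" for Q using False that by (simp add: Suc_le_eq)
    have finB: "finite B" and cardB: "card unmatched = card B + 1"
      using finite_unmatched Q0U card.remove[of unmatched Q0] by (auto simp: B_def)
    have "B \<noteq> {}" using sumB pos[OF Q0U] by auto
    then have "card B \<ge> 2" using odd_unmatched cardB finB
      by (metis One_nat_def Suc_eq_plus1 Suc_leI card_gt_0_iff even_Suc le_neq_implies_less numeral_2_eq_2
          odd_one)
    have "bad_degree Q0 \<le> 4" using degree_split[of Q0] Q0U UK by auto
    have le3: "bad_degree Q \<le> 3" if Q: "Q \<in> B" for Q
    proof -
      obtain R where R: "R \<in> B" "R \<noteq> Q"
        using \<open>card B \<ge> 2\<close> Q finB by (metis One_nat_def card_le_Suc0_iff_eq not_less_eq_eq numeral_2_eq_2)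
      have "bad_degree Q + bad_degree R = (\<Sum>S\<in>{Q, R}. bad_degree S)" using R by simp
      also have "\<dots> \<le> (\<Sum>S\<in>B. bad_degree S)" using R Q finB by (intro sum_mono2) auto
      finally show ?thesis using sumB \<open>bad_degree Q0 \<le> 4\<close> pos[of R] R by (auto simp: B_def)
    qed
    have "sum ?f unmatched = ?f Q0 + sum ?f B"
      unfolding B_def by (rule sum.remove[OF finite_unmatched Q0U])
    moreover have "bad_degree Q0 \<le> sum ?f B"
      unfolding sumB using UK le3 by (intro sum_mono term_bound_bad) (auto simp: B_def)
    moreover have "bad_degree Q0 \<ge> 2"
    proof -
      have "(\<Sum>Q\<in>B. 1) \<le> (\<Sum>Q\<in>B. bad_degree Q)" using pos by (intro sum_mono) (auto simp: B_def)
      then show ?thesis using \<open>card B \<ge> 2\<close> sumB by simp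
    qed
    \<comment> \<open>The leaves pay at least \<open>bad_degree Q0\<close>. This suffices if it is
      4; otherwise the centre pays as much again, and the bad degree is at least 2.\<close>
    moreover have "bad_degree Q0 = 4 \<or> bad_degree Q0 \<le> ?f Q0"
      using term_bound_bad[of Q0] Q0U UK \<open>bad_degree Q0 \<le> 4\<close> by fastforce
    ultimately show ?thesis using le by linarith
  qed
qed

end

section \<open>Colourings of almost complete graphs\<close>

text \<open>Of the eight triangles meeting all three pairs, four are governed by each rule, and each edge lies in
  one triangle of either kind. The correct colour therefore spreads from \<open>y z\<close> along edges that share
  a triangle, provided that \<open>x\<close> misses at most one vertex of the other two pairs.\<close>

lemma octahedron:
  fixes col :: "'a \<Rightarrow> 'a \<Rightarrow> 'c"
  assumes sym: "\<And>a b. adj a b \<Longrightarrow> adj b a" "\<And>a b. col a b = col b a"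
    and rule1: "\<And>a b c. {a, b, c} \<subseteq> W \<Longrightarrow> distinct [a, b, c] \<Longrightarrow> adj a b \<Longrightarrow> adj b c \<Longrightarrow> col a b = L c \<Longrightarrow> col b c = L a"
    and rule2: "\<And>a b c. {a, b, c} \<subseteq> W \<Longrightarrow> distinct [a, b, c] \<Longrightarrow> adj a b \<Longrightarrow> adj b c \<Longrightarrow> col a b = L' c \<Longrightarrow> col b c = L' a"
    and W: "{x, x', y, y', z, z'} \<subseteq> W" and dist: "distinct [x, x', y, y', z, z']"
    and L': "L' x = L x'" "L' x' = L x" "L' y = L y'" "L' y' = L y" "L' z = L z'" "L' z' = L z"
    and yz: "adj y z" "col y z = L x"
    and x: "card {b \<in> {y, y', z, z'}. \<not> adj x b} \<le> 1"
    and ab: "a \<in> {y, y'}" "b \<in> {z, z'}" "adj a b"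
  shows "col a b \<in> {L x, L x'}"
proof -
  have r1: "adj a b \<Longrightarrow> adj b c \<Longrightarrow> col a b = L c \<Longrightarrow> col b c = L a"
    if "{a, b, c} \<subseteq> {x, x', y, y', z, z'}" "distinct [a, b, c]" for a b c
    using rule1[of a b c] that W by blast
  have r2: "adj a b \<Longrightarrow> adj b c \<Longrightarrow> col a b = L' c \<Longrightarrow> col b c = L' a"
    if "{a, b, c} \<subseteq> {x, x', y, y', z, z'}" "distinct [a, b, c]" for a b c
    using rule2[of a b c] that W by blast
  have x2: "adj x p \<or> adj x q" if "p \<in> {y, y', z, z'}" "q \<in> {y, y', z, z'}" "p \<noteq> q" for p q
  proof (rule ccontr)
    assume "\<not> ?thesis"
    then have "card {p, q} \<le> card {b \<in> {y, y', z, z'}. \<not> adj x b}"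
      using that by (intro card_mono) auto
    then show False using x that by simp
  qed
  have d: "x \<noteq> y" "x \<noteq> y'" "x \<noteq> z" "x \<noteq> z'" "y \<noteq> y'" "y \<noteq> z" "y \<noteq> z'" "y' \<noteq> z" "y' \<noteq> z'" "z \<noteq> z'"
    using dist by auto
  have xz: "col x z = L y" if "adj x z"
    using r1[of y z x] yz that d sym by auto
  have xy: "col x y = L z" if "adj x y"
    using r1[of z y x] yz that d sym by auto
  have xy_xz': "col x z' = L y'" if "adj x y" "adj x z'"
    using r2[of y x z'] xy that d sym L' by auto
  have xz_xy': "col x y' = L z'" if "adj x z" "adj x y'"
    using r2[of z x y'] xz that d sym L' by auto
  have xy'_xz': "col x z' = L y'" if "adj x y'" "adj x z'" "col x y' = L z'"
    using r1[of y' x z'] that d sym by auto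
  have xz'_xy': "col x y' = L z'" if "adj x y'" "adj x z'" "col x z' = L y'"
    using r1[of z' x y'] that d sym by auto
  \<comment> \<open>If \<open>x z\<close> is an edge, \<open>xz_xy'\<close> applies. Otherwise
    \<open>z\<close> is the one vertex that \<open>x\<close> misses, and the correct colour passes
    from \<open>x y\<close> over \<open>x z'\<close> to \<open>x y'\<close>.\<close>
  have *: "col x y' = L z'" if "adj x y'"
    using xz_xy' xz'_xy' xy_xz' that x2[of y z] x2[of z z'] d by auto
  have **: "col x z' = L y'" if "adj x z'"
    using xy_xz' xy'_xz' xz_xy' that x2[of y z] x2[of y y'] d by auto
  consider "a = y" "b = z" | "a = y" "b = z'" | "a = y'" "b = z" | "a = y'" "b = z'" using ab by auto
  then show ?thesis
  proof cases
    case 1 then show ?thesis using yz by simp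
  next
    case 2
    have "col y z' = L' x" 
      using r2[of x z' y] r2[of x y z'] ** xy x2[of y z'] 2 ab sym L' d by auto
    then show ?thesis using 2 L' by simp
  next
    case 3
    have "col y' z = L' x"
      using r2[of x z y'] r2[of x y' z] * xz x2[of y' z] 3 ab sym L' d by auto
    then show ?thesis using 3 L' by simp
  next
    case 4
    have "col y' z' = L x"
      using r1[of x z' y'] r1[of x y' z'] * ** x2[of y' z'] 4 ab sym d by auto
    then show ?thesis using 4 by simp
  qed
qed

definition universal_in :: "'a set \<Rightarrow> ('a \<Rightarrow> 'a \<Rightarrow> bool) \<Rightarrow> 'a \<Rightarrow> bool" where
  "universal_in V adj v \<longleftrightarrow> v \<in> V \<and> (\<forall>y\<in>V. y \<noteq> v \<longrightarrow> adj v y)"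

text \<open>Intended for the component of a vertex of degree \<open>t + 1\<close>. The sum in
  \<open>few_missing\<close> counts every missing edge twice.\<close>

locale almost_complete_coloring =
  fixes V :: "'a set" and adj :: "'a \<Rightarrow> 'a \<Rightarrow> bool" and col :: "'a \<Rightarrow> 'a \<Rightarrow> nat" and t :: nat
  assumes finite_V: "finite V" and card_V: "card V = t + 2"
    and adj_V: "adj x y \<Longrightarrow> x \<in> V \<and> y \<in> V \<and> x \<noteq> y"
    and adj_sym: "adj x y \<Longrightarrow> adj y x"
    and col_sym: "col x y = col y x"
    and proper: "adj x y \<Longrightarrow> adj x z \<Longrightarrow> col x y = col x z \<Longrightarrow> y = z"
    and few_missing: "(\<Sum>x\<in>V. card {y \<in> V. y \<noteq> x \<and> \<not> adj x y}) \<le> t"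
    and path_rule: "universal_in V adj v \<Longrightarrow> adj a b \<Longrightarrow> adj b c \<Longrightarrow> distinct [v, a, b, c] \<Longrightarrow>
      col a b = col v c \<Longrightarrow> col b c = col v a"
    and color_rule: "universal_in V adj v \<Longrightarrow> adj a b \<Longrightarrow> \<exists>x. adj v x \<and> col v x = col a b"
begin

abbreviation universal :: "'a \<Rightarrow> bool" where
  "universal \<equiv> universal_in V adj"

definition lacks :: "'a \<Rightarrow> nat \<Rightarrow> bool" where
  "lacks y k \<longleftrightarrow> (\<forall>z. adj y z \<longrightarrow> col y z \<noteq> k)"

definition non_nbrs :: "'a \<Rightarrow> 'a set" where
  "non_nbrs x = {y \<in> V. y \<noteq> x \<and> \<not> adj x y}"

lemma finite_non_nbrs: "finite (non_nbrs x)"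
  using finite_V by (simp add: non_nbrs_def)

lemma universal_adj: "universal v \<Longrightarrow> y \<in> V \<Longrightarrow> y \<noteq> v \<Longrightarrow> adj v y"
  by (simp add: universal_in_def)

lemma adj_commute: "adj x y \<longleftrightarrow> adj y x"
  using adj_sym by blast

lemma proper': "adj y x \<Longrightarrow> adj z x \<Longrightarrow> col y x = col z x \<Longrightarrow> y = z"
  using proper[of x y z] adj_sym col_sym by metis

lemma inj_on_col:
  assumes "universal v"
  shows "inj_on (col v) (V - {v})"
  using assms universal_adj proper by (metis DiffD1 DiffD2 inj_onI insertI1)

text \<open>By \<open>color_rule\<close> every colour is among the \<open>t + 1\<close> colours at
  \<open>v\<close>, and by properness \<open>y\<close> sees as many of them as it has neighbours.
  Missing colours and missing edges at a vertex are therefore equally many.\<close>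

lemma card_lacks:
  assumes v: "universal v" and y: "y \<in> V"
  shows "card {k \<in> col v ` (V - {v}). lacks y k} = card (non_nbrs y)"
proof -
  let ?C = "col v ` (V - {v})" and ?N = "{z. adj y z}"
  have C: "card ?C = t + 1"
    using card_image[OF inj_on_col[OF v]] v card_V finite_V by (simp add: universal_in_def)
  have fin: "finite ?N" using finite_V adj_V by (metis (mono_tags) mem_Collect_eq rev_finite_subset subsetI)
  have NC: "col y ` ?N \<subseteq> ?C" 
  proof
    fix k assume "k \<in> col y ` ?N"
    then obtain z where "adj y z" "k = col y z" by auto
    then obtain x where "adj v x" "col v x = k" using color_rule[OF v] by metis
    then show "k \<in> ?C" using adj_V[of v x] by auto
  qed
  have "card (col y ` ?N) = card ?N" using proper by (intro card_image inj_onI) auto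
  moreover have "{k \<in> ?C. lacks y k} = ?C - col y ` ?N" unfolding lacks_def by blast
  ultimately have "card {k \<in> ?C. lacks y k} = t + 1 - card ?N"
    using card_Diff_subset[of "col y ` ?N" ?C] NC fin C by simp
  moreover have "non_nbrs y = V - insert y ?N" by (auto simp: non_nbrs_def)
  moreover have "card (insert y ?N) = card ?N + 1"
    by (subst card_insert_disjoint) (use fin adj_V in auto)
  moreover have "insert y ?N \<subseteq> V" using y adj_V by auto
  ultimately show ?thesis using card_Diff_subset[of "insert y ?N" V] fin card_V by simp
qed

lemma universal_not_lacks:
  assumes "universal u" "universal v" "x \<in> V" "x \<noteq> v"
  shows "\<not> lacks u (col v x)"
  using color_rule[OF assms(1), of v x] universal_adj[OF assms(2-4)] by (auto simp: lacks_def)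

text \<open>Each vertex that is not universal contributes at least 1 to the sum in
  \<open>few_missing\<close>, so there are at most \<open>t\<close> of them among
  \<open>t + 2\<close>.\<close>

lemma two_universal: "\<exists>v w. universal v \<and> universal w \<and> v \<noteq> w"
proof -
  define A where "A = {v \<in> V. universal v}"
  have "card (V - A) = (\<Sum>x\<in>V - A. 1)" by simp
  also have "\<dots> \<le> (\<Sum>x\<in>V - A. card (non_nbrs x))"
  proof (rule sum_mono)
    fix x assume "x \<in> V - A"
    then have "non_nbrs x \<noteq> {}" by (auto simp: A_def universal_in_def non_nbrs_def)
    then show "1 \<le> card (non_nbrs x)" using finite_non_nbrs[of x] by (simp add: Suc_le_eq card_gt_0_iff)
  qed
  also have "\<dots> \<le> (\<Sum>x\<in>V. card (non_nbrs x))"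
    using finite_V by (intro sum_mono2) auto
  also have "\<dots> \<le> t" using few_missing by (simp add: non_nbrs_def)
  finally have "card A \<ge> 2"
    using card_V finite_V card_Diff_subset[of A V] by (auto simp: A_def)
  then obtain B where "B \<subseteq> A" "card B = 2" by (meson obtain_subset_with_card_n)
  then show ?thesis unfolding card_2_iff A_def by blast
qed

end

locale two_universal_vertices = almost_complete_coloring +
  fixes v w
  assumes v: "universal v" and w: "universal w" and vw: "v \<noteq> w"
    and four_dvd: "4 dvd t" and t_pos: "t > 0"
begin

section \<open>The involution \<open>tau\<close> and its pairs\<close>

definition V' where "V' = V - {v, w}"

definition tau :: "'a \<Rightarrow> 'a" where
  "tau y = (THE z. adj w z \<and> col w z = col v y)"

lemma V_mem: "v \<in> V" "w \<in> V"
  using v w by (auto simp: universal_in_def)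

lemma adj_v: "y \<in> V' \<Longrightarrow> adj v y" and adj_w: "y \<in> V' \<Longrightarrow> adj w y"
  using universal_adj[OF v] universal_adj[OF w] by (auto simp: V'_def)

lemma V'_iff: "y \<in> V' \<longleftrightarrow> y \<in> V \<and> y \<noteq> v \<and> y \<noteq> w"
  by (auto simp: V'_def)

lemma finite_V': "finite V'" using finite_V by (simp add: V'_def)

lemma tau_ex1:
  assumes "y \<in> V'"
  shows "\<exists>!z. adj w z \<and> col w z = col v y"
  using color_rule[OF w adj_v[OF assms]] proper by metis

lemma tau: "y \<in> V' \<Longrightarrow> adj w (tau y) \<and> col w (tau y) = col v y"
  unfolding tau_def by (rule theI') (rule tau_ex1)

lemma tau_eqI: "y \<in> V' \<Longrightarrow> adj w z \<Longrightarrow> col w z = col v y \<Longrightarrow> z = tau y"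
  using tau proper by metis

lemma tau_mem:
  assumes y: "y \<in> V'"
  shows "tau y \<in> V'" "tau y \<noteq> y"
proof -
  have "adj v y" "adj v w" using adj_v[OF y] universal_adj[OF v] V_mem vw by auto
  then show "tau y \<in> V'"
    using tau[OF y] proper[of v y w] adj_V[of w "tau y"] col_sym[of w v] y by (auto simp: V'_iff)
  show "tau y \<noteq> y"
    using tau[OF y] proper'[of v y w] adj_v[OF y] vw by metis
qed

text \<open>The path rule for \<open>tau y, w, y\<close> mirrors the equality that defines
  \<open>tau\<close>: the 4-cycle \<open>v, y, w, tau y\<close> has only two colours. Hence
  \<open>tau\<close> is an involution.\<close>

lemma col_tau:
  assumes y: "y \<in> V'"
  shows "col w y = col v (tau y)"
proof (rule path_rule[OF v])
  show "adj (tau y) w" "adj w y" using tau[OF y] adj_sym adj_w[OF y] by auto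
  show "distinct [v, tau y, w, y]" using tau_mem[OF y] y vw by (auto simp: V'_iff)
  show "col (tau y) w = col v y" using tau[OF y] col_sym by metis
qed

lemma tau_tau: "y \<in> V' \<Longrightarrow> tau (tau y) = y"
  using tau_eqI[of "tau y" y] tau_mem col_tau adj_w by metis

lemma adj_tau:
  assumes y: "y \<in> V'" and adj: "adj y (tau y)"
  shows "col y (tau y) = col v w"
proof -
  have "col (tau y) y = col v w"
  proof (rule path_rule[OF v])
    show "adj w (tau y)" "adj (tau y) y" using tau[OF y] adj_sym adj by auto
    show "distinct [v, w, tau y, y]" using tau_mem[OF y] y vw by (auto simp: V'_iff)
    show "col w (tau y) = col v y" using tau[OF y] by simp
  qed
  then show ?thesis using col_sym by metis
qed

text \<open>The path rule for \<open>y, z, w\<close> gives \<open>col w z = col v y\<close>, which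
  determines \<open>z\<close>. Together with \<open>adj_tau\<close>, inside \<open>V'\<close> the
  colour of \<open>v w\<close> occurs exactly on the edges that join some \<open>y\<close> to
  \<open>tau y\<close>.\<close>

lemma col_vw_tau:
  assumes y: "y \<in> V'" and z: "adj y z" "col y z = col v w"
  shows "z = tau y"
proof (rule tau_eqI[OF y])
  have "y \<noteq> v" "y \<noteq> w" "y \<in> V" using y by (auto simp: V'_iff)
  have "z \<noteq> v" using z proper[of v y w] adj_sym col_sym universal_adj[OF v] V_mem vw \<open>y \<noteq> w\<close> by metis
  moreover have "z \<noteq> w" using z proper'[of y w v] universal_adj[OF v] V_mem vw \<open>y \<noteq> v\<close> by metis
  ultimately show "adj w z" using universal_adj[OF w] adj_V[OF z(1)] by auto
  show "col w z = col v y"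
  proof -
    have "col z w = col v y"
    proof (rule path_rule[OF v z(1)])
      show "adj z w" using \<open>adj w z\<close> adj_sym by auto
      show "distinct [v, y, z, w]" using y \<open>z \<noteq> v\<close> \<open>z \<noteq> w\<close> adj_V[OF z(1)] vw by (auto simp: V'_iff)
    qed (rule z(2))
    then show ?thesis using col_sym by metis
  qed
qed

definition pairs :: "'a set set" where
  "pairs = (\<lambda>y. {y, tau y}) ` V'"

lemma finite_pairs: "finite pairs"
  using finite_V' by (simp add: pairs_def)

lemma card_pairs: "2 * card pairs = t"
proof -
  have "2 * card pairs = card V'"
    unfolding pairs_def using finite_V' tau_mem tau_tau by (intro card_involution_pairs) auto
  then show ?thesis using card_V V_mem vw finite_V by (simp add: V'_def)
qed

lemma pair_cases:
  assumes "P \<in> pairs" "x \<in> P"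
  shows "P = {x, tau x}" "x \<in> V'"
  using assms tau_tau tau_mem by (auto simp: pairs_def)

lemma pairE:
  assumes "P \<in> pairs"
  obtains x where "P = {x, tau x}" "x \<in> V'"
  using assms by (auto simp: pairs_def)

lemma pair_mem: "x \<in> V' \<Longrightarrow> {x, tau x} \<in> pairs"
  by (auto simp: pairs_def)

lemma pair_finite: "P \<in> pairs \<Longrightarrow> finite P"
  by (auto simp: pairs_def)

lemma card_pair: "P \<in> pairs \<Longrightarrow> card P = 2"
  by (elim pairE) (use tau_mem in \<open>auto simp: card_2_iff\<close>)

lemma pairs_disjoint: "P \<in> pairs \<Longrightarrow> Q \<in> pairs \<Longrightarrow> x \<in> P \<Longrightarrow> x \<in> Q \<Longrightarrow> P = Q"
  using pair_cases by metis

lemma pair_subset: "P \<in> pairs \<Longrightarrow> P \<subseteq> V'"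
  using pair_cases by blast

lemma sum_pairs: "(\<Sum>Q\<in>pairs. \<Sum>a\<in>Q. f a) = (\<Sum>a\<in>V'. f a)"
proof -
  have "\<Union>pairs = V'" using pair_subset pair_mem by blast
  moreover have "sum f (\<Union>pairs) = (sum \<circ> sum) f pairs"
    using pair_finite pairs_disjoint by (intro sum.Union_disjoint ballI impI) blast+
  ultimately show ?thesis by (simp add: comp_def)
qed

lemma sum_other_pairs:
  fixes f :: "'a \<Rightarrow> nat"
  assumes "P \<in> pairs"
  shows "(\<Sum>Q\<in>pairs - {P}. \<Sum>a\<in>Q. f a) = (\<Sum>a\<in>V' - P. f a)"
proof -
  have "(\<Sum>a\<in>V'. f a) = (\<Sum>a\<in>V' - P. f a) + (\<Sum>a\<in>P. f a)"
    using assms finite_V' pair_subset by (intro sum.subset_diff) auto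
  moreover have "(\<Sum>Q\<in>pairs. \<Sum>a\<in>Q. f a) = (\<Sum>a\<in>P. f a) + (\<Sum>Q\<in>pairs - {P}. \<Sum>a\<in>Q. f a)"
    using assms finite_pairs by (intro sum.remove) auto
  ultimately show ?thesis using sum_pairs[of f] by simp
qed

definition pair_colors :: "'a set \<Rightarrow> nat set" where
  "pair_colors P = col v ` P"

lemma inj_on_col_V': "inj_on (col v) V'"
  using inj_on_col[OF v] by (rule inj_on_subset) (auto simp: V'_iff)

lemma card_pair_colors: "P \<in> pairs \<Longrightarrow> card (pair_colors P) = 2"
  using card_pair pair_subset inj_on_col_V' unfolding pair_colors_def
  by (metis card_image inj_on_subset)

lemma finite_pair_colors: "P \<in> pairs \<Longrightarrow> finite (pair_colors P)"
  using pair_finite by (simp add: pair_colors_def)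

lemma pair_colors_mem: "P \<in> pairs \<Longrightarrow> x \<in> V' \<Longrightarrow> col v x \<in> pair_colors P \<longleftrightarrow> x \<in> P"
  using pair_subset inj_on_col_V' unfolding pair_colors_def by (metis inj_on_image_mem_iff)

lemma pair_colors_disjoint:
  assumes "P \<in> pairs" "Q \<in> pairs" "k \<in> pair_colors P" "k \<in> pair_colors Q"
  shows "P = Q"
proof -
  obtain x where "x \<in> P" "k = col v x" using assms by (auto simp: pair_colors_def)
  then show ?thesis using assms pair_colors_mem[of Q x] pairs_disjoint pair_subset by blast
qed

lemma col_vw_notin: "P \<in> pairs \<Longrightarrow> col v w \<notin> pair_colors P"
proof
  assume P: "P \<in> pairs" and "col v w \<in> pair_colors P"
  then obtain x where "x \<in> P" "col v w = col v x" by (auto simp: pair_colors_def)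
  moreover have "x \<in> V'" using pair_subset[OF P] \<open>x \<in> P\<close> by blast
  ultimately show False
    using inj_onD[OF inj_on_col[OF v], of w x] V_mem vw by (auto simp: V'_iff)
qed

text \<open>At \<open>v\<close> and \<open>w\<close> the colours of \<open>P\<close> lead to
  \<open>P\<close>, so the vertices of \<open>P\<close> spend these colours on \<open>v\<close> and
  \<open>w\<close>. Outside \<open>P\<close> they only join vertices outside \<open>P\<close>, and
  not partners, whose edge has the colour of \<open>v w\<close>.\<close>

lemma pair_color_edge:
  assumes P: "P \<in> pairs" and y: "y \<in> V' - P" and z: "adj y z" "col y z \<in> pair_colors P"
  shows "z \<in> V' - P" "z \<noteq> tau y"
proof -
  have yV: "y \<in> V'" "tau y \<notin> P"
    using y pair_cases[OF P, of "tau y"] tau_tau by auto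
  have "z \<noteq> v" using z y pair_colors_mem[OF P yV(1)] col_sym by auto
  moreover have "z \<noteq> w"
    using z yV pair_colors_mem[OF P tau_mem(1)[OF yV(1)]] col_tau[OF yV(1)] col_sym[of w y] by auto
  moreover have "z \<notin> P"
  proof
    assume zP: "z \<in> P"
    then have Pz: "P = {z, tau z}" "z \<in> V'" using pair_cases[OF P] by auto
    then consider "col y z = col v z" | "col y z = col w z"
      using z(2) col_tau[OF Pz(2)] by (auto simp: pair_colors_def)
    then show False
      by cases (use proper'[of y z v] proper'[of y z w] adj_v[OF Pz(2)] adj_w[OF Pz(2)] z yV in
          \<open>auto simp: V'_iff\<close>)
  qed
  ultimately show "z \<in> V' - P" using adj_V[OF z(1)] by (auto simp: V'_iff)
  show "z \<noteq> tau y" using adj_tau[OF yV(1)] z col_vw_notin[OF P] by auto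
qed

section \<open>Edges between pairs in the colours of a fixed pair\<close>

definition colored_edges :: "'a set \<Rightarrow> 'a set \<Rightarrow> 'a set \<Rightarrow> nat" where
  "colored_edges P Q R = (\<Sum>a\<in>Q. \<Sum>b\<in>R. of_bool (adj a b \<and> col a b \<in> pair_colors P))"

definition non_edges :: "'a set \<Rightarrow> 'a set \<Rightarrow> nat" where
  "non_edges Q R = (\<Sum>a\<in>Q. \<Sum>b\<in>R. of_bool (\<not> adj a b))"

definition deficit :: "'a set \<Rightarrow> 'a set \<Rightarrow> nat" where
  "deficit P S = (\<Sum>a\<in>S. \<Sum>k\<in>pair_colors P. of_bool (lacks a k))"

text \<open>The negation supplies a vertex of \<open>P\<close> missing at most one vertex of
  \<open>Q\<close> and \<open>R\<close>, as \<open>octahedron\<close> requires.\<close>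

definition bad :: "'a set \<Rightarrow> 'a set \<Rightarrow> 'a set \<Rightarrow> bool" where
  "bad P Q R \<longleftrightarrow> (\<forall>p\<in>P. 2 \<le> card {b \<in> Q \<union> R. \<not> adj p b})"

lemma color_degree:
  assumes P: "P \<in> pairs" and a: "a \<in> V' - P"
  shows "(\<Sum>b\<in>V' - P. of_bool (adj a b \<and> col a b \<in> pair_colors P))
    + (\<Sum>k\<in>pair_colors P. of_bool (lacks a k)) = (2::nat)"
proof -
  let ?B = "{b \<in> V' - P. adj a b \<and> col a b \<in> pair_colors P}"
  have img: "col a ` ?B = {k \<in> pair_colors P. \<not> lacks a k}"
    using pair_color_edge(1)[OF P a] by (fastforce simp: lacks_def)
  have "card ?B = card (col a ` ?B)" using proper by (intro card_image[symmetric] inj_onI) auto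
  moreover have "card {k \<in> pair_colors P. \<not> lacks a k} + card {k \<in> pair_colors P. lacks a k} =
      card (pair_colors P)"
    using finite_pair_colors[OF P]
    by (subst card_Un_disjoint[symmetric]) (auto intro: arg_cong[of _ _ card])
  ultimately show ?thesis
    using img finite_V' finite_pair_colors[OF P] card_pair_colors[OF P]
    by (simp add: sum_of_bool_eq Int_def)
qed

lemma colored_edges_sym: "colored_edges P Q R = colored_edges P R Q"
  unfolding colored_edges_def by (subst sum.swap) (simp add: adj_commute col_sym)

lemma colored_edges_irrefl:
  assumes "P \<in> pairs" "Q \<in> pairs - {P}"
  shows "colored_edges P Q Q = 0"
proof -
  have "\<not> (adj a b \<and> col a b \<in> pair_colors P)" if ab: "a \<in> Q" "b \<in> Q" for a b
  proof
    assume *: "adj a b \<and> col a b \<in> pair_colors P"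
    have Q: "Q = {a, tau a}" "a \<in> V'" using pair_cases[of Q a] assms ab by auto
    moreover have "a \<notin> P" using assms ab pairs_disjoint[of P Q a] by auto
    ultimately show False
      using pair_color_edge(2)[OF assms(1), of a b] * ab adj_V[of a b] by auto
  qed
  then show ?thesis unfolding colored_edges_def by (intro sum.neutral ballI) simp
qed

lemma colored_degree:
  assumes P: "P \<in> pairs" and Q: "Q \<in> pairs - {P}"
  shows "(\<Sum>R\<in>pairs - {P}. colored_edges P Q R) + deficit P Q = 4"
proof -
  let ?f = "\<lambda>a b. of_bool (adj a b \<and> col a b \<in> pair_colors P) :: nat"
  have QV: "Q \<subseteq> V' - P" using Q P pair_subset pairs_disjoint by blast
  have "(\<Sum>R\<in>pairs - {P}. colored_edges P Q R) = (\<Sum>a\<in>Q. \<Sum>R\<in>pairs - {P}. \<Sum>b\<in>R. ?f a b)"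
    unfolding colored_edges_def by (rule sum.swap)
  also have "\<dots> = (\<Sum>a\<in>Q. \<Sum>b\<in>V' - P. ?f a b)"
    using sum_other_pairs[OF P] by simp
  finally have "(\<Sum>R\<in>pairs - {P}. colored_edges P Q R) + deficit P Q =
      (\<Sum>a\<in>Q. (\<Sum>b\<in>V' - P. ?f a b) + (\<Sum>k\<in>pair_colors P. of_bool (lacks a k)))"
    by (simp add: deficit_def sum.distrib)
  also have "\<dots> = (\<Sum>a\<in>Q. 2)"
    using color_degree[OF P] QV by (intro sum.cong) auto
  finally show ?thesis using card_pair[of Q] Q by simp
qed

text \<open>Divisibility by 4 makes the number \<open>t/2\<close> of pairs even, so an odd number
  remains without \<open>P\<close>.\<close>

lemma odd_multigraph_pairs:
  assumes "P \<in> pairs"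
  shows "odd_multigraph (pairs - {P}) (colored_edges P) (deficit P) (bad P)"
proof
  show "finite (pairs - {P})" using finite_pairs by simp
  have "even (card pairs)" "card pairs > 0" using card_pairs four_dvd t_pos by (auto elim!: dvdE)
  then show "odd (card (pairs - {P}))"
    using card.remove[OF finite_pairs assms] by (metis even_Suc)
  show "colored_edges P Q R = colored_edges P R Q" for Q R by (rule colored_edges_sym)
  show "colored_edges P Q Q = 0" if "Q \<in> pairs - {P}" for Q
    using colored_edges_irrefl assms that by blast
  show "(\<Sum>R\<in>pairs - {P}. colored_edges P Q R) + deficit P Q = 4" if "Q \<in> pairs - {P}" for Q
    using colored_degree assms that by blast
  show "bad P R Q" if "bad P Q R" for Q R
    using that by (simp add: bad_def Un_commute)
qed

lemma pair_colors_pair: "x \<in> V' \<Longrightarrow> pair_colors {x, tau x} = {col v x, col v (tau x)}"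
  by (simp add: pair_colors_def)

lemma rule_v:
  assumes "{a, b, c} \<subseteq> V'" "distinct [a, b, c]" "adj a b" "adj b c" "col a b = col v c"
  shows "col b c = col v a"
  using path_rule[OF v, of a b c] assms by (auto simp: V'_iff)

lemma rule_w:
  assumes "{a, b, c} \<subseteq> V'" "distinct [a, b, c]" "adj a b" "adj b c" "col a b = col w c"
  shows "col b c = col w a"
  using path_rule[OF w, of a b c] assms by (auto simp: V'_iff)

lemma all_colored:
  assumes P: "P \<in> pairs" and QR: "Q \<in> pairs - {P}" "R \<in> pairs - {P}" "Q \<noteq> R"
    and nb: "\<not> bad P Q R" and pos: "colored_edges P Q R > 0"
    and ab: "a \<in> Q" "b \<in> R" "adj a b"
  shows "col a b \<in> pair_colors P"
proof -
  obtain y z where yz: "y \<in> Q" "z \<in> R" "adj y z" "col y z \<in> pair_colors P"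
  proof -
    have "\<exists>y\<in>Q. \<exists>z\<in>R. adj y z \<and> col y z \<in> pair_colors P"
    proof (rule ccontr)
      assume "\<not> ?thesis"
      then have "colored_edges P Q R = 0" unfolding colored_edges_def by (intro sum.neutral ballI) auto
      then show False using pos by simp
    qed
    then show ?thesis using that by blast
  qed
  obtain x where x: "x \<in> P" "col y z = col v x" using yz by (auto simp: pair_colors_def)
  have Q: "Q = {y, tau y}" "y \<in> V'" and R: "R = {z, tau z}" "z \<in> V'" and P': "P = {x, tau x}" "x \<in> V'"
    using pair_cases yz x QR P by auto
  have dist: "distinct [x, tau x, y, tau y, z, tau z]"
  proof -
    have "Q \<inter> R = {}" "P \<inter> Q = {}" "P \<inter> R = {}"
      using pairs_disjoint QR P by blast+
    then show ?thesis using Q R P' tau_mem(2)[OF Q(2)] tau_mem(2)[OF R(2)] tau_mem(2)[OF P'(2)] by auto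
  qed
  have W: "{x, tau x, y, tau y, z, tau z} \<subseteq> V'" using Q R P' tau_mem by auto
  have eqs: "col w u = col v (tau u)" "col w (tau u) = col v u" if "u \<in> V'" for u
    using col_tau[OF that] tau[OF that] by auto
  obtain p where p: "p \<in> P" "\<not> 2 \<le> card {b \<in> Q \<union> R. \<not> adj p b}" using nb by (auto simp: bad_def)
  have QR_eq: "Q \<union> R = {y, tau y, z, tau z}" using Q R by auto
  have few: "card {b \<in> {y, tau y, z, tau z}. \<not> adj p b} \<le> 1" using p(2) unfolding QR_eq by simp
  have ab': "a \<in> {y, tau y}" "b \<in> {z, tau z}" using ab Q R by auto
  consider "p = x" | "p = tau x" using p P' by auto
  then show ?thesis
  proof cases
    case 1
    have "col a b \<in> {col v x, col v (tau x)}"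
      by (rule octahedron[where adj=adj and col=col and W=V' and L="col v" and L'="col w",
            OF adj_sym col_sym rule_v rule_w W dist eqs[OF P'(2)] eqs[OF Q(2)] eqs[OF R(2)]
              yz(3) x(2) few[unfolded 1] ab' ab(3)])
    then show ?thesis using P' by (simp add: pair_colors_pair)
  next
    case 2
    \<comment> \<open>Exchanging \<open>v\<close> and \<open>w\<close> exchanges the two path rules,
      and \<open>col w (tau x) = col v x\<close>. So \<open>octahedron\<close> applies again with
      \<open>tau x\<close> in place of \<open>x\<close>.\<close>
    have dist': "distinct [tau x, x, y, tau y, z, tau z]" using dist by auto
    have yz': "col y z = col w (tau x)" using x(2) eqs(2)[OF P'(2)] by simp
    have W': "{tau x, x, y, tau y, z, tau z} \<subseteq> V'" using W by auto
    have "col a b \<in> {col w (tau x), col w x}"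
      by (rule octahedron[where adj=adj and col=col and W=V' and L="col w" and L'="col v",
            OF adj_sym col_sym rule_w rule_v W' dist' eqs[OF P'(2), symmetric]
              eqs(2,1)[OF Q(2), symmetric] eqs(2,1)[OF R(2), symmetric]
              yz(3) yz' few[unfolded 2] ab' ab(3)])
    then show ?thesis using P' eqs by (auto simp: pair_colors_pair)
  qed
qed

definition excess :: "'a set \<Rightarrow> nat" where
  "excess P = (\<Sum>Q\<in>pairs - {P}. odd_multigraph.cost (pairs - {P}) (colored_edges P) (bad P) Q)"

definition outside :: "'a set \<Rightarrow> nat" where
  "outside P = (\<Sum>R\<in>pairs - {P}. non_edges P R)"

lemma outside_eq:
  assumes "P \<in> pairs"
  shows "outside P = (\<Sum>a\<in>P. card {b \<in> V' - P. \<not> adj a b})"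
proof -
  have "outside P = (\<Sum>a\<in>P. \<Sum>R\<in>pairs - {P}. \<Sum>b\<in>R. of_bool (\<not> adj a b))"
    unfolding outside_def non_edges_def by (rule sum.swap)
  also have "\<dots> = (\<Sum>a\<in>P. \<Sum>b\<in>V' - P. of_bool (\<not> adj a b))"
    using sum_other_pairs[OF assms] by simp
  finally show ?thesis using finite_V' by (simp add: sum_of_bool_eq Int_def)
qed

lemma deficit_other_pairs:
  assumes "P \<in> pairs"
  shows "(\<Sum>Q\<in>pairs - {P}. deficit P Q) \<le> deficit P V"
  unfolding deficit_def sum_other_pairs[OF assms]
  using finite_V by (intro sum_mono2) (auto simp: V'_iff)

lemma excess_sum:
  "(\<Sum>Q\<in>pairs - {P}. 3 * deficit P Q + odd_multigraph.cost (pairs - {P}) (colored_edges P) (bad P) Q)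
    = 3 * (\<Sum>Q\<in>pairs - {P}. deficit P Q) + excess P"
  by (simp add: excess_def sum.distrib sum_distrib_left)

text \<open>Summed over the \<open>t/2\<close> pairs, each of the three quantities is at most \<open>total_missing \<le> t\<close>, so an
  average weight of 12 is exactly borderline. The alternatives supply the slack.\<close>

lemma pair_weight:
  assumes P: "P \<in> pairs"
  shows "12 \<le> 3 * deficit P V + excess P \<or>
    4 \<le> outside P \<and> 12 \<le> 3 * deficit P V + excess P + 2 * outside P"
proof (cases "\<exists>Q\<in>pairs - {P}. \<exists>R\<in>pairs - {P}. Q \<noteq> R \<and> bad P Q R")
  case False
  interpret odd_multigraph "pairs - {P}" "colored_edges P" "deficit P" "bad P"
    by (rule odd_multigraph_pairs[OF P])
  have "12 \<le> (\<Sum>Q\<in>pairs - {P}. 3 * deficit P Q + cost Q)"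
    using False by (intro sum_ge_12) blast
  then show ?thesis using excess_sum[of P] deficit_other_pairs[OF P] by linarith
next
  case True
  then obtain Q R where QR: "Q \<in> pairs - {P}" "R \<in> pairs - {P}" "bad P Q R" by blast
  let ?N = "\<lambda>p. {b \<in> V' - P. \<not> adj p b}"
  have sub: "{b \<in> Q' \<union> R'. \<not> adj p b} \<subseteq> ?N p" if "Q' \<in> pairs - {P}" "R' \<in> pairs - {P}" for Q' R' p
    using that P pair_subset pairs_disjoint by blast
  have finN: "finite (?N p)" for p using finite_V' by simp
  have N2: "2 \<le> card (?N p)" if "p \<in> P" for p
    using QR that card_mono[OF finN sub[OF QR(1,2)], of p] by (fastforce simp: bad_def)
  have "(\<Sum>p\<in>P. 2) \<le> outside P"
    unfolding outside_eq[OF P] using N2 by (rule sum_mono)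
  then have o4: "4 \<le> outside P" using card_pair[OF P] by simp
  show ?thesis
  proof (cases "outside P \<ge> 6")
    case True
    then show ?thesis by simp
  next
    case False
    \<comment> \<open>As \<open>outside P\<close> is at most 5, some \<open>p\<close> misses exactly
      two vertices outside \<open>P\<close>. Two pairs that are bad for \<open>P\<close> must
      contain both, so one of them is always the pair of \<open>b\<close>. Then
      \<open>sum_ge_4\<close> gives 4, and \<open>2 * outside P\<close> gives the other 8.\<close>
    have "\<exists>p\<in>P. card (?N p) \<le> 2"
    proof (rule ccontr)
      assume "\<not> ?thesis"
      then have "(\<Sum>p\<in>P. 3) \<le> outside P"
        unfolding outside_eq[OF P] by (intro sum_mono) fastforce
      then show False using card_pair[OF P] False by simp
    qed
    then obtain p where p: "p \<in> P" "card (?N p) \<le> 2" by blast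
    have "card (?N p) > 0" using N2[OF p(1)] by linarith
    then obtain b where b: "b \<in> ?N p" unfolding card_gt_0_iff by blast
    interpret odd_multigraph "pairs - {P}" "colored_edges P" "deficit P" "bad P"
      by (rule odd_multigraph_pairs[OF P])
    have "4 \<le> (\<Sum>Q\<in>pairs - {P}. 3 * deficit P Q + cost Q)"
    proof (rule sum_ge_4[of "{b, tau b}"])
      fix Q' R' assume *: "Q' \<in> pairs - {P}" "R' \<in> pairs - {P}" "bad P Q' R'"
      have "{c \<in> Q' \<union> R'. \<not> adj p c} = ?N p"
        using sub[OF *(1,2)] finN p *(3) by (intro card_seteq) (fastforce simp: bad_def)+
      then have "b \<in> Q' \<union> R'" using b by blast
      then show "Q' = {b, tau b} \<or> R' = {b, tau b}" using pair_cases * by blast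
    qed
    then show ?thesis using excess_sum[of P] deficit_other_pairs[OF P] o4 by linarith
  qed
qed

section \<open>Charging the costs to missing edges\<close>

definition owns :: "'a set \<Rightarrow> 'a set \<Rightarrow> 'a set \<Rightarrow> bool" where
  "owns P Q R \<longleftrightarrow> P \<in> pairs \<and> Q \<in> pairs - {P} \<and> R \<in> pairs - {P} \<and> \<not> bad P Q R \<and> colored_edges P Q R > 0"

lemma owns_neq: "owns P Q R \<Longrightarrow> Q \<noteq> R"
  unfolding owns_def using colored_edges_irrefl by (metis less_numeral_extra(3))

lemma owns_colored:
  assumes "owns P Q R" "a \<in> Q" "b \<in> R" "adj a b"
  shows "col a b \<in> pair_colors P"
  using all_colored[of P Q R a b] assms owns_neq[OF assms(1)] by (auto simp: owns_def)

text \<open>All edges between \<open>Q\<close> and \<open>R\<close> have colours of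
  \<open>P\<close>, so the multiplicity falls short of 4 exactly by the missing ones.\<close>

lemma owns_non_edges:
  assumes own: "owns P Q R"
  shows "4 - colored_edges P Q R = non_edges Q R"
proof -
  have "colored_edges P Q R + non_edges Q R = (\<Sum>a\<in>Q. \<Sum>b\<in>R. 1)"
    unfolding colored_edges_def non_edges_def sum.distrib[symmetric]
    using owns_colored[OF own] by (intro sum.cong) auto
  also have "\<dots> = 4" using card_pair[of Q] card_pair[of R] own by (simp add: owns_def)
  finally show ?thesis by simp
qed

lemma owns_unique:
  assumes own: "owns P Q R" "owns P' Q R"
  shows "P = P'"
proof -
  have "\<exists>a\<in>Q. \<exists>b\<in>R. adj a b"
  proof (rule ccontr)
    assume "\<not> ?thesis"
    then have "colored_edges P Q R = 0" unfolding colored_edges_def by (intro sum.neutral ballI) auto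
    then show False using own by (simp add: owns_def)
  qed
  then obtain a b where "a \<in> Q" "b \<in> R" "adj a b" by blast
  then show ?thesis
    using owns_colored[OF own(1)] owns_colored[OF own(2)] pair_colors_disjoint own
    by (metis owns_def)
qed

lemma cost_eq_owned:
  assumes "P \<in> pairs" "Q \<in> pairs - {P}"
  shows "odd_multigraph.cost (pairs - {P}) (colored_edges P) (bad P) Q
    = (\<Sum>R\<in>pairs. of_bool (owns P Q R) * non_edges Q R)"
proof -
  interpret odd_multigraph "pairs - {P}" "colored_edges P" "deficit P" "bad P"
    by (rule odd_multigraph_pairs[OF assms(1)])
  have "cost Q = (\<Sum>R\<in>nbrs Q. non_edges Q R)"
    unfolding cost_def using assms by (intro sum.cong owns_non_edges) (auto simp: nbrs_def owns_def)
  also have "\<dots> = (\<Sum>R\<in>pairs. if owns P Q R then non_edges Q R else 0)"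
    unfolding sum.inter_filter[OF finite_pairs, symmetric]
    using assms by (intro sum.cong) (auto simp: nbrs_def owns_def)
  also have "\<dots> = (\<Sum>R\<in>pairs. of_bool (owns P Q R) * non_edges Q R)"
    by (intro sum.cong) auto
  finally show ?thesis .
qed

text \<open>By \<open>cost_eq_owned\<close> the excess counts missing edges between \<open>Q\<close>
  and \<open>R\<close> owned by \<open>P\<close>. An ordered pair \<open>(Q, R)\<close> has at most
  one owner, because distinct pairs have disjoint colour sets.\<close>

lemma sum_excess: "(\<Sum>P\<in>pairs. excess P) \<le> (\<Sum>P\<in>pairs. outside P)"
proof -
  have "excess P = (\<Sum>Q\<in>pairs. \<Sum>R\<in>pairs. of_bool (owns P Q R) * non_edges Q R)"
    if "P \<in> pairs" for P
  proof -
    have "excess P = (\<Sum>Q\<in>pairs - {P}. \<Sum>R\<in>pairs. of_bool (owns P Q R) * non_edges Q R)"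
      unfolding excess_def using cost_eq_owned[OF that] by simp
    also have "\<dots> = (\<Sum>Q\<in>pairs. \<Sum>R\<in>pairs. of_bool (owns P Q R) * non_edges Q R)"
      by (rule sum.mono_neutral_left) (auto simp: finite_pairs owns_def)
    finally show ?thesis .
  qed
  then have "(\<Sum>P\<in>pairs. excess P)
      = (\<Sum>P\<in>pairs. \<Sum>Q\<in>pairs. \<Sum>R\<in>pairs. of_bool (owns P Q R) * non_edges Q R)"
    by simp
  also have "\<dots> = (\<Sum>Q\<in>pairs. \<Sum>P\<in>pairs. \<Sum>R\<in>pairs. of_bool (owns P Q R) * non_edges Q R)"
    by (rule sum.swap)
  also have "\<dots> = (\<Sum>Q\<in>pairs. \<Sum>R\<in>pairs. \<Sum>P\<in>pairs. of_bool (owns P Q R) * non_edges Q R)"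
    by (intro sum.cong refl sum.swap)
  also have "\<dots> \<le> (\<Sum>Q\<in>pairs. \<Sum>R\<in>pairs. if Q \<noteq> R then non_edges Q R else 0)"
  proof (intro sum_mono)
    fix Q R
    have "(\<Sum>P\<in>pairs. of_bool (owns P Q R) :: nat) \<le> 1"
    proof -
      have "card {P \<in> pairs. owns P Q R} \<le> 1"
        unfolding One_nat_def using finite_pairs
        by (subst card_le_Suc0_iff_eq) (simp, use owns_unique in blast)
      then show ?thesis using finite_pairs by (simp add: sum_of_bool_eq Int_def)
    qed
    moreover have "(\<Sum>P\<in>pairs. of_bool (owns P Q R) :: nat) = 0" if "Q = R"
      using owns_neq that by (intro sum.neutral) auto
    ultimately show "(\<Sum>P\<in>pairs. of_bool (owns P Q R) * non_edges Q R)
        \<le> (if Q \<noteq> R then non_edges Q R else 0)"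
      unfolding sum_distrib_right[symmetric] by (cases "Q = R") auto
  qed
  also have "\<dots> = (\<Sum>Q\<in>pairs. outside Q)"
  proof (intro sum.cong refl)
    fix Q
    show "(\<Sum>R\<in>pairs. if Q \<noteq> R then non_edges Q R else 0) = outside Q"
      unfolding outside_def sum.inter_filter[OF finite_pairs, symmetric]
      by (intro sum.cong) auto
  qed
  finally show ?thesis .
qed

section \<open>Global balance of missing edges and missing colours\<close>

definition total_missing :: nat where
  "total_missing = (\<Sum>x\<in>V. card (non_nbrs x))"

definition central_deficit :: nat where
  "central_deficit = (\<Sum>a\<in>V. of_bool (lacks a (col v w)))"

text \<open>The colours at \<open>v\<close> are those of the pairs together with
  \<open>col v w\<close>; \<open>card_lacks\<close> converts missing colours into missing
  edges.\<close>

lemma sum_deficit: "(\<Sum>P\<in>pairs. deficit P V) + central_deficit = total_missing"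
proof -
  let ?l = "\<lambda>a x. of_bool (lacks a (col v x)) :: nat"
  have "deficit P V = (\<Sum>a\<in>V. \<Sum>x\<in>P. ?l a x)" if "P \<in> pairs" for P
    unfolding deficit_def pair_colors_def
    using inj_on_subset[OF inj_on_col_V' pair_subset[OF that]]
    by (intro sum.cong refl) (simp add: sum.reindex)
  then have "(\<Sum>P\<in>pairs. deficit P V) = (\<Sum>P\<in>pairs. \<Sum>a\<in>V. \<Sum>x\<in>P. ?l a x)" by simp
  also have "\<dots> = (\<Sum>a\<in>V. \<Sum>P\<in>pairs. \<Sum>x\<in>P. ?l a x)" by (rule sum.swap)
  also have "\<dots> = (\<Sum>a\<in>V. \<Sum>x\<in>V'. ?l a x)" by (simp add: sum_pairs)
  finally have "(\<Sum>P\<in>pairs. deficit P V) + central_deficit = (\<Sum>a\<in>V. (\<Sum>x\<in>V'. ?l a x) + ?l a w)"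
    by (simp add: central_deficit_def sum.distrib)
  also have "\<dots> = total_missing"
    unfolding total_missing_def
  proof (intro sum.cong refl)
    fix a assume a: "a \<in> V"
    have "V - {v} = insert w V'" "w \<notin> V'" using V_mem vw by (auto simp: V'_def)
    then have "(\<Sum>x\<in>V'. ?l a x) + ?l a w = (\<Sum>x\<in>V - {v}. ?l a x)" using finite_V' by simp
    also have "\<dots> = (\<Sum>k\<in>col v ` (V - {v}). of_bool (lacks a k))"
      using inj_on_col[OF v] by (simp add: sum.reindex)
    also have "\<dots> = card {k \<in> col v ` (V - {v}). lacks a k}"
      using finite_V by (simp add: sum_of_bool_eq Int_def)
    finally show "(\<Sum>x\<in>V'. ?l a x) + ?l a w = card (non_nbrs a)"
      using card_lacks[OF v a] by simp
  qed
  finally show ?thesis .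
qed

text \<open>If \<open>a\<close> lacks \<open>col v w\<close>, then the edge from \<open>a\<close> to
  \<open>tau a\<close> is missing, and \<open>outside\<close> does not count it.\<close>

lemma sum_outside: "(\<Sum>P\<in>pairs. outside P) + central_deficit \<le> total_missing"
proof -
  let ?g = "\<lambda>a. card {b \<in> V' - {a, tau a}. \<not> adj a b}"
  have "outside P = (\<Sum>a\<in>P. ?g a)" if "P \<in> pairs" for P
    unfolding outside_eq[OF that] using pair_cases(1)[OF that] by (intro sum.cong) auto
  then have "(\<Sum>P\<in>pairs. outside P) = (\<Sum>a\<in>V'. ?g a)" using sum_pairs[of ?g] by simp
  moreover have "central_deficit = (\<Sum>a\<in>V'. of_bool (lacks a (col v w)))"
    unfolding central_deficit_def
  proof (rule sum.mono_neutral_right)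
    show "\<forall>a\<in>V - V'. of_bool (lacks a (col v w)) = (0::nat)"
      using universal_not_lacks[OF v v, of w] universal_not_lacks[OF w v, of w] V_mem vw
      by (auto simp: V'_iff)
  qed (auto simp: finite_V V'_iff)
  moreover have "(\<Sum>a\<in>V'. ?g a + of_bool (lacks a (col v w))) \<le> (\<Sum>a\<in>V'. card (non_nbrs a))"
  proof (rule sum_mono)
    fix a assume a: "a \<in> V'"
    have sub: "{b \<in> V' - {a, tau a}. \<not> adj a b} \<subseteq> non_nbrs a - {tau a}"
      by (auto simp: V'_iff non_nbrs_def)
    then have le: "?g a \<le> card (non_nbrs a - {tau a})"
      using finite_non_nbrs by (intro card_mono) auto
    show "?g a + of_bool (lacks a (col v w)) \<le> card (non_nbrs a)"
    proof (cases "lacks a (col v w)")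
      case True
      then have "\<not> adj a (tau a)" using adj_tau[OF a] by (auto simp: lacks_def)
      then have "tau a \<in> non_nbrs a" using tau_mem[OF a] by (auto simp: V'_iff non_nbrs_def)
      then show ?thesis using le True unfolding card.remove[OF finite_non_nbrs \<open>tau a \<in> non_nbrs a\<close>] by simp
    next
      case False
      have "card (non_nbrs a - {tau a}) \<le> card (non_nbrs a)"
        using finite_non_nbrs by (intro card_mono) auto
      then show ?thesis using le False by simp
    qed
  qed
  moreover have "(\<Sum>a\<in>V'. card (non_nbrs a)) \<le> total_missing"
    unfolding total_missing_def using finite_V by (intro sum_mono2) (auto simp: V'_iff)
  ultimately show ?thesis by (simp add: sum.distrib)
qed

lemma total_missing_le: "total_missing \<le> t"
  using few_missing by (simp add: total_missing_def non_nbrs_def)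

text \<open>Over the \<open>t/2\<close> pairs the weights of \<open>pair_weight\<close> add up to at
  least \<open>6 * t\<close>. The sums of \<open>deficit\<close>, \<open>excess\<close> and
  \<open>outside\<close> are each at most \<open>t - central_deficit\<close>, and their coefficients
  3, 1, 2 add up to 6.\<close>

lemma central_deficit_0: "central_deficit = 0"
proof -
  have "(\<Sum>P\<in>pairs. 12) \<le> (\<Sum>P\<in>pairs. 3 * deficit P V + excess P + 2 * outside P)"
    using pair_weight by (intro sum_mono) fastforce
  also have "\<dots> = 3 * (\<Sum>P\<in>pairs. deficit P V) + (\<Sum>P\<in>pairs. excess P) + 2 * (\<Sum>P\<in>pairs. outside P)"
    by (simp add: sum.distrib sum_distrib_left)
  finally show ?thesis
    using sum_deficit sum_outside sum_excess total_missing_le card_pairs by simp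
qed

text \<open>Since \<open>central_deficit\<close> vanishes, every \<open>a\<close> is adjacent to
  \<open>tau a\<close>, so a vertex missed by \<open>a\<close> lies in another pair.\<close>

lemma outside_ge_2:
  assumes P: "P \<in> pairs" and nu: "\<And>x. x \<in> P \<Longrightarrow> \<not> universal x"
  shows "2 \<le> outside P"
proof -
  have "1 \<le> card {b \<in> V' - P. \<not> adj a b}" if a: "a \<in> P" for a
  proof -
    have aP: "P = {a, tau a}" "a \<in> V'" using pair_cases[OF P a] .
    obtain b where b: "b \<in> V" "b \<noteq> a" "\<not> adj a b"
      using nu[OF a] aP by (auto simp: universal_in_def V'_iff)
    have "\<not> lacks a (col v w)"
      using central_deficit_0 aP finite_V by (auto simp: central_deficit_def V'_iff)
    then have "adj a (tau a)" using col_vw_tau[OF aP(2)] by (auto simp: lacks_def)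
    then have "b \<in> V' - P"
      using b adj_v[OF aP(2)] adj_w[OF aP(2)] adj_sym aP by (auto simp: V'_iff)
    then have "{b \<in> V' - P. \<not> adj a b} \<noteq> {}" using b by blast
    then show ?thesis using finite_V' by (simp add: Suc_le_eq card_gt_0_iff)
  qed
  then have "(\<Sum>a\<in>P. 1) \<le> outside P" unfolding outside_eq[OF P] by (rule sum_mono)
  then show ?thesis using card_pair[OF P] by simp
qed

lemma deficit_universal:
  assumes P: "P \<in> pairs" and x: "x \<in> P" "universal x"
    and no: "\<And>u u' y. universal u \<Longrightarrow> universal u' \<Longrightarrow> u \<noteq> u' \<Longrightarrow> y \<in> V \<Longrightarrow> \<not> lacks y (col u u')"
  shows "deficit P V = 0"
proof -
  have Px: "P = {x, tau x}" "x \<in> V'" using pair_cases[OF P x(1)] .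
  have "\<not> lacks a k" if "a \<in> V" "k \<in> pair_colors P" for a k
    using no[OF v x(2)] no[OF w x(2)] that Px col_tau[OF Px(2)]
    by (auto simp: pair_colors_pair V'_iff)
  then show ?thesis unfolding deficit_def by (intro sum.neutral ballI) auto
qed

text \<open>Otherwise the borderline estimate improves: a pair with a universal vertex has deficit
  0, since its colours are those of two edges between universal vertices, and any other pair has
  \<open>outside\<close> at least 2. Summing the improved bound yields
  \<open>11 * t / 2 <= 5 * t\<close>.\<close>

lemma universal_lacks_witness:
  "\<exists>u u' y. universal u \<and> universal u' \<and> u \<noteq> u' \<and> y \<in> V \<and> lacks y (col u u')"
proof (rule ccontr)
  assume no: "\<not> ?thesis"
  have "11 + deficit P V \<le> 3 * deficit P V + excess P + 2 * outside P" if P: "P \<in> pairs" for P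
  proof (cases "\<exists>x\<in>P. universal x")
    case True
    then have "deficit P V = 0" using deficit_universal[OF P] no by blast
    then show ?thesis using pair_weight[OF P] by auto
  next
    case False
    \<comment> \<open>Let \<open>D\<close> be the deficit; one copy of it is given away. First
      alternative: \<open>12 - D + 4 >= 11\<close> if \<open>D <= 5\<close>, else
      \<open>2 * D >= 12\<close>. Second: \<open>12 - D >= 11\<close> if \<open>D <= 1\<close>, else
      \<open>2 * D + 8 >= 12\<close>.\<close>
    then show ?thesis using pair_weight[OF P] outside_ge_2[OF P] by fastforce
  qed
  then have "(\<Sum>P\<in>pairs. 11 + deficit P V) \<le> (\<Sum>P\<in>pairs. 3 * deficit P V + excess P + 2 * outside P)"
    by (intro sum_mono)
  also have "\<dots> = 3 * (\<Sum>P\<in>pairs. deficit P V) + (\<Sum>P\<in>pairs. excess P) + 2 * (\<Sum>P\<in>pairs. outside P)"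
    by (simp add: sum.distrib sum_distrib_left)
  finally have "11 * card pairs + (\<Sum>P\<in>pairs. deficit P V) \<le>
      3 * (\<Sum>P\<in>pairs. deficit P V) + (\<Sum>P\<in>pairs. excess P) + 2 * (\<Sum>P\<in>pairs. outside P)"
    by (simp add: sum.distrib)
  then show False
    using sum_deficit sum_outside sum_excess total_missing_le card_pairs central_deficit_0 t_pos by linarith
qed

end

context almost_complete_coloring
begin

text \<open>The construction is run twice. The first run gives universal \<open>u, u'\<close> whose
  colour some vertex lacks; with \<open>u, u'\<close> as the distinguished vertices the central
  deficit is then positive.\<close>

lemma four_not_dvd:
  assumes "t > 0"
  shows "\<not> 4 dvd t"
proof
  assume dvd: "4 dvd t"
  obtain v w where vw: "universal v" "universal w" "v \<noteq> w" using two_universal by blast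
  interpret A: two_universal_vertices V adj col t v w
    using vw dvd assms by unfold_locales
  obtain u u' y where u: "universal u" "universal u'" "u \<noteq> u'" "y \<in> V" "lacks y (col u u')"
    using A.universal_lacks_witness by blast
  interpret B: two_universal_vertices V adj col t u u'
    using u dvd assms by unfold_locales
  show False using B.central_deficit_0 u finite_V by (auto simp: B.central_deficit_def)
qed

end

section \<open>Reduction to almost complete components\<close>

lemma even_sum_sym_relation:
  assumes "finite S" and irrefl: "\<And>x. \<not> r x x" and sym: "\<And>x y. r x y \<Longrightarrow> r y x"
  shows "even (\<Sum>x\<in>S. card {y \<in> S. r x y})"
proof -
  let ?A = "SIGMA x:S. {y \<in> S. r x y}"
  have "2 * card ((\<lambda>p. {p, prod.swap p}) ` ?A) = card ?A"
  proof (rule card_involution_pairs)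
    show "finite ?A" using assms(1) by auto
    fix p assume "p \<in> ?A"
    then obtain x y where p: "p = (x, y)" "x \<in> S" "y \<in> S" "r x y" by auto
    then have "x \<noteq> y" "r y x" using irrefl sym by auto
    then show "prod.swap p \<in> ?A \<and> prod.swap p \<noteq> p \<and> prod.swap (prod.swap p) = p" using p by auto
  qed
  moreover have "card ?A = (\<Sum>x\<in>S. card {y \<in> S. r x y})"
    using assms(1) by simp
  ultimately have "(\<Sum>x\<in>S. card {y \<in> S. r x y}) = 2 * card ((\<lambda>p. {p, prod.swap p}) ` ?A)"
    by (simp only:)
  then show ?thesis by (rule dvdI)
qed

text \<open>A missing edge at \<open>a\<close> or \<open>b\<close> is counted at both of its ends,
  and none joins \<open>a\<close> to \<open>b\<close>.\<close>

lemma sum_non_nbrs_ge: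
  assumes S: "finite S" "a \<in> S" "b \<in> S" and ab: "adj a b" "a \<noteq> b"
    and sym: "\<And>x y. adj x y \<Longrightarrow> adj y x"
  shows "2 * (card {y \<in> S. y \<noteq> a \<and> \<not> adj a y} + card {y \<in> S. y \<noteq> b \<and> \<not> adj b y})
    \<le> (\<Sum>x\<in>S. card {y \<in> S. y \<noteq> x \<and> \<not> adj x y})"
proof -
  let ?N = "\<lambda>x. {y \<in> S. y \<noteq> x \<and> \<not> adj x y}" and ?R = "S - {a, b}"
  have eq: "card (?N z) = (\<Sum>x\<in>?R. of_bool (\<not> adj x z))" if "z \<in> {a, b}" for z
  proof -
    have "adj z x = adj x z" for x using sym[of z x] sym[of x z] by blast
    then have "?N z = {x \<in> ?R. \<not> adj x z}" using that ab by auto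
    then show ?thesis using S by (simp add: sum_of_bool_eq Int_def)
  qed
  have "card (?N a) + card (?N b) = (\<Sum>x\<in>?R. of_bool (\<not> adj x a) + of_bool (\<not> adj x b))"
    by (simp add: eq sum.distrib)
  also have "\<dots> \<le> (\<Sum>x\<in>?R. card (?N x))"
  proof (rule sum_mono)
    fix x assume "x \<in> ?R"
    then have "{y \<in> {a, b}. \<not> adj x y} \<subseteq> ?N x" using S by auto
    then have "card {y \<in> {a, b}. \<not> adj x y} \<le> card (?N x)" using S by (intro card_mono) auto
    moreover have "{y \<in> {a, b}. \<not> adj x y} =
        (if adj x a then {} else {a}) \<union> (if adj x b then {} else {b})" by auto
    ultimately show "of_bool (\<not> adj x a) + of_bool (\<not> adj x b) \<le> card (?N x)"
      using ab(2) by (cases "adj x a"; cases "adj x b") simp_all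
  qed
  finally have le: "card (?N a) + card (?N b) \<le> (\<Sum>x\<in>?R. card (?N x))" .
  have "card (?N a) + card (?N b) \<le> (\<Sum>x\<in>{a, b}. card (?N x))" using ab(2) by simp
  from add_mono[OF le this] have "2 * (card (?N a) + card (?N b)) \<le> (\<Sum>x\<in>?R. card (?N x)) + (\<Sum>x\<in>{a, b}. card (?N x))"
    by (simp only: mult_2)
  also have "\<dots> = (\<Sum>x\<in>S. card (?N x))" using S by (intro sum.subset_diff[symmetric]) auto
  finally show ?thesis .
qed

text \<open>In \<open>few_bristles\<close> only the colours of \<open>v a\<close> and
  \<open>b d\<close> are compared, since the other edges of the path are incident. Fewer than
  \<open>t - 3\<close> bristles remain at \<open>v\<close>, too few for a broom.\<close>

locale broom_free_coloring =
  fixes V :: "'a set" and adj :: "'a \<Rightarrow> 'a \<Rightarrow> bool" and col :: "'a \<Rightarrow> 'a \<Rightarrow> nat" and t :: nat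
  assumes finite_V: "finite V"
    and adj_V: "adj x y \<Longrightarrow> x \<in> V \<and> y \<in> V \<and> x \<noteq> y"
    and adj_sym: "adj x y \<Longrightarrow> adj y x"
    and col_sym: "col x y = col y x"
    and proper: "adj x y \<Longrightarrow> adj x z \<Longrightarrow> col x y = col x z \<Longrightarrow> y = z"
    and few_bristles: "adj v a \<Longrightarrow> adj a b \<Longrightarrow> adj b d \<Longrightarrow> distinct [v, a, b, d] \<Longrightarrow>
      col v a \<noteq> col b d \<Longrightarrow>
      card {x. adj v x \<and> x \<notin> {a, b, d} \<and> col v x \<notin> {col a b, col b d}} < t - 3"
    and four_dvd: "4 dvd t" and t_pos: "t > 0"
begin

definition nbh :: "'a \<Rightarrow> 'a set" where
  "nbh x = {y. adj x y}"

lemma finite_nbh: "finite (nbh x)"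
  by (rule finite_subset[OF _ finite_V]) (use adj_V in \<open>auto simp: nbh_def\<close>)

lemma t_ge_4: "t \<ge> 4"
  using four_dvd t_pos by (rule dvd_imp_le)

lemma color_nbr_subset: "\<exists>u. {x. adj v x \<and> col v x = k} \<subseteq> {u}"
  using proper by blast

text \<open>For a rainbow path, each of the five possible reasons to reject a neighbour of its start
  as a bristle concerns at most one neighbour.\<close>

lemma blocked_ge:
  assumes path: "adj v a" "adj a b" "adj b d" "distinct [v, a, b, d]" "col v a \<noteq> col b d"
    and B: "finite B" "{x. adj v x \<and> (x \<in> {a, b, d} \<or> col v x \<in> {col a b, col b d})} \<subseteq> B"
  shows "card (nbh v) < t - 3 + card B"
proof -
  let ?G = "{x. adj v x \<and> x \<notin> {a, b, d} \<and> col v x \<notin> {col a b, col b d}}"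
  have "nbh v \<subseteq> ?G \<union> B" using B by (auto simp: nbh_def)
  moreover have "finite ?G" by (rule finite_subset[OF _ finite_nbh[of v]]) (auto simp: nbh_def)
  ultimately have "card (nbh v) \<le> card (?G \<union> B)" using B by (intro card_mono) auto
  also have "\<dots> \<le> card ?G + card B" by (rule card_Un_le)
  finally show ?thesis using few_bristles[OF path] by linarith
qed

text \<open>At most five rejections bound the degree by \<open>t + 1\<close>, while four would leave
  \<open>t - 3\<close> bristles. So \<open>a\<close>, \<open>b\<close>, \<open>d\<close> and the
  neighbours \<open>p\<close>, \<open>q\<close> in the colours of \<open>a b\<close> and
  \<open>b d\<close> must be five distinct neighbours of \<open>v\<close>. If one of the last three
  conclusions failed, one would be absent or two would coincide.\<close>

lemma rainbow_path_start:
  assumes path: "adj v a" "adj a b" "adj b d" "distinct [v, a, b, d]" "col v a \<noteq> col b d"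
    and deg: "card (nbh v) \<ge> t + 1"
  shows "card (nbh v) = t + 1" "adj v b" "col v d \<noteq> col a b"
    "\<exists>x. adj v x \<and> col v x = col a b"
proof -
  obtain p where p: "{x. adj v x \<and> col v x = col a b} \<subseteq> {p}" using color_nbr_subset by blast
  obtain q where q: "{x. adj v x \<and> col v x = col b d} \<subseteq> {q}" using color_nbr_subset by blast
  have sub: "{x. adj v x \<and> (x \<in> {a, b, d} \<or> col v x \<in> {col a b, col b d})} \<subseteq> {a, b, d, p, q}"
    using p q by auto
  have no4: False
    if "{x. adj v x \<and> (x \<in> {a, b, d} \<or> col v x \<in> {col a b, col b d})} \<subseteq> set xs" "length xs \<le> 4" for xs
    using blocked_ge[OF path finite_set that(1)] card_length[of xs] that(2) deg t_ge_4 by linarith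
  have "card (nbh v) < t - 3 + card {a, b, d, p, q}"
    using blocked_ge[OF path _ sub] by simp
  moreover have "card {a, b, d, p, q} \<le> 5" using card_length[of "[a, b, d, p, q]"] by simp
  ultimately show "card (nbh v) = t + 1" using deg t_ge_4 by linarith
  show "adj v b"
  proof (rule ccontr)
    assume "\<not> adj v b" then show False using no4[of "[a, d, p, q]"] p q by auto
  qed
  show "col v d \<noteq> col a b"
  proof
    assume *: "col v d = col a b"
    then have "x = d" if "adj v x" "col v x = col a b" for x
      using that p proper[of v x d] no4[of "[a, b, p, q]"] q by (cases "adj v d") auto
    then show False using no4[of "[a, b, d, q]"] q by auto
  qed
  show "\<exists>x. adj v x \<and> col v x = col a b"
  proof (rule ccontr)
    assume "\<nexists>x. adj v x \<and> col v x = col a b"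
    then show False using no4[of "[a, b, d, q]"] q by auto
  qed
qed

text \<open>To be avoided are \<open>a\<close>, \<open>v\<close> and the neighbour of
  \<open>b\<close> in the colour of \<open>v a\<close>; if \<open>v\<close> is not adjacent to
  \<open>b\<close>, degree 3 suffices.\<close>

lemma extend_path:
  assumes "adj v a" "adj a b" "b \<noteq> v" and deg: "card (nbh b) \<ge> 4 \<or> card (nbh b) \<ge> 3 \<and> \<not> adj v b"
  obtains d where "adj b d" "distinct [v, a, b, d]" "col v a \<noteq> col b d"
proof -
  obtain q where q: "{x. adj b x \<and> col b x = col v a} \<subseteq> {q}" using color_nbr_subset by blast
  have "\<not> nbh b \<subseteq> {a, v, q}"
  proof
    assume sub: "nbh b \<subseteq> {a, v, q}"
    have "card (nbh b) \<le> 3"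
      using card_mono[OF _ sub] card_length[of "[a, v, q]"] by simp
    then have "\<not> adj b v" "card (nbh b) \<ge> 3" using deg adj_sym by auto
    then have "nbh b \<subseteq> {a, q}" using sub by (auto simp: nbh_def)
    then have "card (nbh b) \<le> 2" using card_mono[of "{a, q}" "nbh b"] card_length[of "[a, q]"] by simp
    then show False using \<open>card (nbh b) \<ge> 3\<close> by simp
  qed
  then obtain d where "d \<in> nbh b" "d \<notin> {a, v, q}" by blast
  then show thesis using that[of d] q assms adj_V by (fastforce simp: nbh_def)
qed

end

text \<open>The sum is twice the number of edges that meet \<open>S\<close>, so deleting
  \<open>S\<close> always costs more than \<open>t/2\<close> edges per deleted vertex.\<close>

locale irreducible_broom_free = broom_free_coloring +
  assumes irreducible: "S \<subseteq> V \<Longrightarrow> S \<noteq> {} \<Longrightarrow>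
    t * card S < (\<Sum>x\<in>S. card (nbh x) + card (nbh x - S))"
    and V_nonempty: "V \<noteq> {}"
begin

lemma degree_gt_half:
  assumes "u \<in> V"
  shows "t < 2 * card (nbh u)"
proof -
  have "nbh u - {u} = nbh u" using adj_V by (auto simp: nbh_def)
  then show ?thesis using irreducible[of "{u}"] assms by simp
qed

lemma degree_ge_3: "u \<in> V \<Longrightarrow> card (nbh u) \<ge> 3"
  using degree_gt_half[of u] t_ge_4 by linarith

lemma closed_sum:
  assumes "S \<subseteq> V" "S \<noteq> {}" "\<And>x y. x \<in> S \<Longrightarrow> adj x y \<Longrightarrow> y \<in> S"
  shows "t * card S < (\<Sum>x\<in>S. card (nbh x))"
proof -
  have "nbh x - S = {}" if "x \<in> S" for x using assms(3) that by (auto simp: nbh_def)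
  then have "(\<Sum>x\<in>S. card (nbh x) + card (nbh x - S)) = (\<Sum>x\<in>S. card (nbh x))"
    by (intro sum.cong) (simp_all only: card.empty add_0_right)
  then show ?thesis using irreducible[OF assms(1,2)] by simp
qed

lemma ex_high_degree: "\<exists>v\<in>V. card (nbh v) \<ge> t + 1"
proof (rule ccontr)
  assume "\<not> ?thesis"
  then have "(\<Sum>x\<in>V. card (nbh x)) \<le> (\<Sum>x\<in>V. t)" by (intro sum_mono) fastforce
  moreover have "t * card V < (\<Sum>x\<in>V. card (nbh x))"
    using V_nonempty adj_V by (intro closed_sum) auto
  ultimately show False by (simp add: mult.commute)
qed

text \<open>As \<open>b\<close> has degree at least 3, a missing edge \<open>v b\<close> would allow
  an extension to a rainbow path \<open>v, a, b, d\<close>, and then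
  \<open>rainbow_path_start\<close> forces \<open>v b\<close> to be an edge. Thus \<open>v\<close>
  and its neighbours form a component.\<close>

lemma second_nbr:
  assumes deg: "card (nbh v) \<ge> t + 1" and ab: "adj v a" "adj a b" "b \<noteq> v"
  shows "adj v b"
proof (rule ccontr)
  assume nb: "\<not> adj v b"
  have "card (nbh b) \<ge> 3" using degree_ge_3 adj_V ab by blast
  then obtain d where "adj b d" "distinct [v, a, b, d]" "col v a \<noteq> col b d"
    using extend_path[OF ab] nb by blast
  then show False using rainbow_path_start(2)[OF ab(1,2)] deg nb by blast
qed

lemma closed_nbh:
  assumes "card (nbh v) \<ge> t + 1" "x \<in> insert v (nbh v)" "adj x y"
  shows "y \<in> insert v (nbh v)"
  using second_nbr[OF assms(1)] assms by (auto simp: nbh_def)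

lemma card_insert_nbh: "card (insert v (nbh v)) = card (nbh v) + 1"
  using adj_V[of v v] finite_nbh[of v] by (subst card_insert_disjoint) (auto simp: nbh_def)

lemma insert_nbh_sum:
  assumes "card (nbh v) \<ge> t + 1"
  shows "t * (card (nbh v) + 1) < (\<Sum>x\<in>insert v (nbh v). card (nbh x))"
proof -
  have "nbh v \<noteq> {}" using assms by auto
  then have "insert v (nbh v) \<subseteq> V" using adj_V by (auto simp: nbh_def)
  then show ?thesis
    using closed_sum[of "insert v (nbh v)"] closed_nbh[OF assms] card_insert_nbh by simp
qed

text \<open>Without a rainbow path starting at \<open>v\<close>, all neighbours of \<open>v\<close> have degree 3, which makes the
  component of \<open>v\<close> sparse.\<close>

lemma degree_le:
  assumes "card (nbh v) \<ge> t + 1"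
  shows "card (nbh v) = t + 1"
proof (rule ccontr)
  assume ne: "card (nbh v) \<noteq> t + 1"
  have le3: "card (nbh b) \<le> 3" if ab: "adj v a" "adj a b" "b \<noteq> v" for a b
  proof (rule ccontr)
    assume "\<not> ?thesis"
    then have "card (nbh b) \<ge> 4" by simp
    then obtain d where "adj b d" "distinct [v, a, b, d]" "col v a \<noteq> col b d"
      using extend_path[OF ab] by blast
    then show False using rainbow_path_start(1)[OF ab(1,2)] assms ne by blast
  qed
  have "card (nbh a) \<le> 3" if a: "a \<in> nbh v" for a
  proof -
    have "\<not> nbh a \<subseteq> {v}"
      using degree_ge_3[of a] adj_V[of v a] a card_mono[of "{v}" "nbh a"] by (auto simp: nbh_def)
    then obtain b where "adj a b" "b \<noteq> v" by (auto simp: nbh_def)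
    \<comment> \<open>By \<open>second_nbr\<close>, \<open>b\<close> is adjacent to
      \<open>v\<close>, so \<open>le3\<close> applies to the path \<open>v, b, a\<close>.\<close>
    then show ?thesis
      using le3[of b a] second_nbr[OF assms, of a b] a adj_sym adj_V by (auto simp: nbh_def)
  qed
  then have "(\<Sum>x\<in>nbh v. card (nbh x)) \<le> (\<Sum>x\<in>nbh v. 3)" by (rule sum_mono)
  moreover have "v \<notin> nbh v" using adj_V by (auto simp: nbh_def)
  ultimately have "(\<Sum>x\<in>insert v (nbh v). card (nbh x)) \<le> 4 * card (nbh v)"
    using finite_nbh by simp
  also have "\<dots> \<le> t * (card (nbh v) + 1)" using t_ge_4 by (intro mult_mono) auto
  finally show False using insert_nbh_sum[OF assms] by simp
qed

lemma irreducible_impossible: False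
proof -
  obtain v where v: "v \<in> V" "card (nbh v) \<ge> t + 1" using ex_high_degree by blast
  define S where "S = insert v (nbh v)"
  have deg_v: "card (nbh v) = t + 1" using degree_le[OF v(2)] .
  have finS: "finite S" and cardS: "card S = t + 2"
    using finite_nbh card_insert_nbh deg_v by (auto simp: S_def)
  have closed: "y \<in> S" if "x \<in> S" "adj x y" for x y
    using closed_nbh[OF v(2)] that by (auto simp: S_def)
  let ?M = "\<lambda>x. {y \<in> S. y \<noteq> x \<and> \<not> adj x y}"
  have cardM: "card (?M x) + card (nbh x) = t + 1" if x: "x \<in> S" for x
  proof -
    have "S - {x} = ?M x \<union> nbh x" "?M x \<inter> nbh x = {}"
      using closed[OF x] adj_V by (auto simp: nbh_def)
    then have "card (S - {x}) = card (?M x) + card (nbh x)"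
      using finS finite_nbh card_Un_disjoint[of "?M x" "nbh x"] by simp
    then show ?thesis using x finS cardS by simp
  qed
  have "(\<Sum>x\<in>S. card (?M x)) + (\<Sum>x\<in>S. card (nbh x)) = (t + 2) * (t + 1)"
    unfolding sum.distrib[symmetric] using cardM cardS by simp
  moreover have "t * (t + 2) < (\<Sum>x\<in>S. card (nbh x))"
    using insert_nbh_sum[OF v(2)] deg_v by (simp add: S_def)
  ultimately have "(\<Sum>x\<in>S. card (?M x)) \<le> t + 1" by (simp add: algebra_simps)
  \<comment> \<open>The count only gives \<open>t + 1\<close>. This number is odd and the sum is
    even, so the bound improves to \<open>t\<close>.\<close>
  moreover have "even (\<Sum>x\<in>S. card (?M x))"
    using finS adj_sym by (intro even_sum_sym_relation) auto
  moreover have "odd (t + 1)" using four_dvd by (auto elim!: dvdE)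
  ultimately have few: "(\<Sum>x\<in>S. card (?M x)) \<le> t"
    by (cases "(\<Sum>x\<in>S. card (?M x)) = t + 1") (simp only:, simp only: le_Suc_eq Suc_eq_plus1[symmetric] simp_thms)
  let ?adj = "\<lambda>x y. adj x y \<and> x \<in> S \<and> y \<in> S"
  have univ: "u \<in> S" "card (nbh u) = t + 1" "\<And>x. x \<in> S \<Longrightarrow> x \<noteq> u \<Longrightarrow> adj u x"
    if u: "universal_in S ?adj u" for u
  proof -
    show uS: "u \<in> S" and adj_u: "\<And>x. x \<in> S \<Longrightarrow> x \<noteq> u \<Longrightarrow> adj u x"
      using u unfolding universal_in_def by blast+
    then have "?M u = {}" by blast
    then show "card (nbh u) = t + 1" using cardM[OF uS] by (simp only: card.empty add_0_left)
  qed
  have rule: "col b c = col u a"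
    if u: "universal_in S ?adj u" and abc: "?adj a b" "?adj b c" "distinct [u, a, b, c]" "col a b = col u c"
    for u a b c
  proof (rule ccontr)
    assume "col b c \<noteq> col u a"
    moreover have "adj u a" using univ(3)[OF u, of a] abc by auto
    ultimately show False
      using rainbow_path_start(3)[of u a b c] univ(2)[OF u] abc by simp
  qed
  have color1: "\<exists>x. adj u x \<and> col u x = col a b"
    if u: "universal_in S ?adj u" and ab: "?adj a b" "a \<noteq> u" "b \<noteq> u" "card (nbh b) \<ge> 4" for u a b
  proof -
    have ua: "adj u a" using univ(3)[OF u, of a] ab by simp
    obtain d where "adj b d" "distinct [u, a, b, d]" "col u a \<noteq> col b d"
      using extend_path[OF ua] ab by blast
    then show ?thesis using rainbow_path_start(4)[OF ua] univ(2)[OF u] ab by simp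
  qed
  have color: "\<exists>x. adj u x \<and> col u x = col a b" if u: "universal_in S ?adj u" and ab: "?adj a b" for u a b
  proof -
    have "a \<noteq> b" using ab adj_V by auto
    have "2 * (card (?M a) + card (?M b)) \<le> (\<Sum>x\<in>S. card (?M x))"
      by (rule sum_non_nbrs_ge) (use ab finS adj_sym \<open>a \<noteq> b\<close> in blast)+
    then have le_t: "2 * (card (?M a) + card (?M b)) \<le> t" using few by (rule le_trans)
    \<comment> \<open>The two degrees add up to at least \<open>2 * (t + 1) - t/2\<close>, which is
      at least 8 for \<open>t >= 4\<close>. So one end of the edge has degree at least 4 and admits
      \<open>extend_path\<close>.\<close>
    have "8 \<le> x + y" if "2 * (m + n) \<le> t" "m + x = t + 1" "n + y = t + 1" for m n x y
      using that t_ge_4 unfolding mult_2 by linarith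
    from this[OF le_t cardM cardM] have "8 \<le> card (nbh a) + card (nbh b)" using ab by blast
    then have deg4: "card (nbh a) \<ge> 4 \<or> card (nbh b) \<ge> 4" by linarith
    have "adj b a" using ab adj_sym by blast
    consider "a = u" | "b = u" | "a \<noteq> u" "b \<noteq> u" "card (nbh b) \<ge> 4" | "a \<noteq> u" "b \<noteq> u" "card (nbh a) \<ge> 4"
      using deg4 by blast
    then show ?thesis
    proof cases
      case 1 then show ?thesis using ab by blast
    next
      case 2 then show ?thesis using \<open>adj b a\<close> col_sym by blast
    next
      case 3 then show ?thesis using color1[OF u] ab by blast
    next
      case 4 then show ?thesis using color1[OF u, of b a] ab \<open>adj b a\<close> unfolding col_sym[of b a] by blast
    qed
  qed
  interpret almost_complete_coloring S ?adj col t
  proof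
    show "(\<Sum>x\<in>S. card {y \<in> S. y \<noteq> x \<and> \<not> (adj x y \<and> x \<in> S \<and> y \<in> S)}) \<le> t"
    proof -
      have "(\<Sum>x\<in>S. card {y \<in> S. y \<noteq> x \<and> \<not> (adj x y \<and> x \<in> S \<and> y \<in> S)}) = (\<Sum>x\<in>S. card (?M x))"
        by (intro sum.cong refl arg_cong[of _ _ card]) auto
      then show ?thesis using few by simp
    qed
    show "\<exists>x. ?adj u x \<and> col u x = col a b"
      if ab: "universal_in S ?adj u" "?adj a b" for u a b
    proof -
      obtain x where "adj u x" "col u x = col a b" using color[OF ab] by blast
      then show ?thesis using univ(1)[OF ab(1)] closed[of u x] by blast
    qed
    show "col b c = col u a"
      if "universal_in S ?adj u" "?adj a b" "?adj b c" "distinct [u, a, b, c]" "col a b = col u c"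
      for u a b c by (rule rule[OF that])
    show "col x y = col y x" for x y by (rule col_sym)
    show "x \<in> S \<and> y \<in> S \<and> x \<noteq> y" if "?adj x y" for x y using that adj_V by blast
    show "?adj y x" if "?adj x y" for x y using that adj_sym by blast
    show "y = z" if "?adj x y" "?adj x z" "col x y = col x z" for x y z
      using that proper by blast
  qed (fact finS cardS)+
  show False using four_not_dvd[OF t_pos] four_dvd by (rule notE)
qed

end

text \<open>Induction by deletion: removing a set \<open>S\<close> that violates irreducibility
  lowers the degree sum by at most \<open>t * card S\<close>, and a nonempty graph without such a
  set is impossible.\<close>

lemma broom_free_degree_sum:
  assumes "broom_free_coloring V adj col t"
  shows "(\<Sum>x\<in>V. card {y. adj x y}) \<le> t * card V"
  using assms
proof (induction "card V" arbitrary: V adj rule: less_induct)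
  case less
  interpret broom_free_coloring V adj col t by (rule less.prems)
  show ?case
  proof (cases "V = {} \<or> (\<forall>S. S \<subseteq> V \<longrightarrow> S \<noteq> {} \<longrightarrow> t * card S < (\<Sum>x\<in>S. card (nbh x) + card (nbh x - S)))")
    case True
    then show ?thesis
    proof
      assume "\<forall>S. S \<subseteq> V \<longrightarrow> S \<noteq> {} \<longrightarrow> t * card S < (\<Sum>x\<in>S. card (nbh x) + card (nbh x - S))"
      then have "V \<noteq> {} \<Longrightarrow> irreducible_broom_free V adj col t"
        using less.prems
        by (simp only: irreducible_broom_free_def irreducible_broom_free_axioms_def simp_thms)
      then have "V = {}" using irreducible_broom_free.irreducible_impossible by blast
      then show ?thesis by simp
    qed simp
  next
    case False
    then obtain S where S: "S \<subseteq> V" "S \<noteq> {}" "(\<Sum>x\<in>S. card (nbh x) + card (nbh x - S)) \<le> t * card S"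
      by (auto simp: not_less)
    let ?W = "V - S"
    let ?adj = "\<lambda>x y. adj x y \<and> x \<in> ?W \<and> y \<in> ?W"
    have "broom_free_coloring ?W ?adj col t"
    proof
      show "card {x. ?adj v x \<and> x \<notin> {a, b, d} \<and> col v x \<notin> {col a b, col b d}} < t - 3"
        if "?adj v a" "?adj a b" "?adj b d" "distinct [v, a, b, d]" "col v a \<noteq> col b d" for v a b d
      proof -
        have "card {x. ?adj v x \<and> x \<notin> {a, b, d} \<and> col v x \<notin> {col a b, col b d}}
            \<le> card {x. adj v x \<and> x \<notin> {a, b, d} \<and> col v x \<notin> {col a b, col b d}}"
          by (rule card_mono) (auto intro: finite_subset[OF _ finite_nbh[of v]] simp: nbh_def)
        then show ?thesis using few_bristles[of v a b d] that by simp
      qed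
      show "finite ?W" using finite_V by simp
      show "col x y = col y x" for x y by (rule col_sym)
      show "x \<in> ?W \<and> y \<in> ?W \<and> x \<noteq> y" if "?adj x y" for x y using that adj_V by blast
      show "?adj y x" if "?adj x y" for x y using that adj_sym by blast
      show "y = z" if "?adj x y" "?adj x z" "col x y = col x z" for x y z
        using that proper by blast
    qed (fact four_dvd t_pos)+
    moreover have "card ?W < card V" using S finite_V by (intro psubset_card_mono) auto
    ultimately have IH: "(\<Sum>x\<in>?W. card {y. ?adj x y}) \<le> t * card ?W" using less.hyps by blast
    have split: "card (nbh x) = card {y. ?adj x y} + card (nbh x \<inter> S)" if "x \<in> ?W" for x
    proof -
      have "nbh x = {y. ?adj x y} \<union> (nbh x \<inter> S)" using that adj_V by (auto simp: nbh_def)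
      moreover have "finite {y. ?adj x y}"
        by (rule finite_subset[OF _ finite_nbh[of x]]) (auto simp: nbh_def)
      ultimately show ?thesis
        using card_Un_disjoint[of "{y. ?adj x y}" "nbh x \<inter> S"] finite_nbh[of x] by auto
    qed
    have "(\<Sum>x\<in>?W. card (nbh x \<inter> S)) = (\<Sum>x\<in>?W. \<Sum>y\<in>S. of_bool (adj x y))"
    proof (intro sum.cong refl)
      fix x
      have "finite S" using S finite_V finite_subset by blast
      then show "card (nbh x \<inter> S) = (\<Sum>y\<in>S. of_bool (adj x y))"
        by (simp add: sum_of_bool_eq nbh_def Int_commute)
    qed
    also have "\<dots> = (\<Sum>y\<in>S. \<Sum>x\<in>?W. of_bool (adj x y))" by (rule sum.swap)
    also have "\<dots> = (\<Sum>y\<in>S. card (nbh y - S))"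
    proof (intro sum.cong refl)
      fix y
      have "?W \<inter> {x. adj x y} = nbh y - S" using adj_V adj_sym by (auto simp: nbh_def)
      then show "(\<Sum>x\<in>?W. of_bool (adj x y)) = card (nbh y - S)"
        using finite_V by (simp add: sum_of_bool_eq)
    qed
    finally have cross: "(\<Sum>x\<in>?W. card (nbh x \<inter> S)) = (\<Sum>y\<in>S. card (nbh y - S))" .
    have "(\<Sum>x\<in>V. card (nbh x)) = (\<Sum>x\<in>?W. card (nbh x)) + (\<Sum>x\<in>S. card (nbh x))"
      using S finite_V by (intro sum.subset_diff) auto
    also have "(\<Sum>x\<in>?W. card (nbh x)) = (\<Sum>x\<in>?W. card {y. ?adj x y}) + (\<Sum>y\<in>S. card (nbh y - S))"
      unfolding cross[symmetric] sum.distrib[symmetric] using split by (intro sum.cong) auto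
    also have "\<dots> + (\<Sum>x\<in>S. card (nbh x)) \<le> t * card ?W + t * card S"
      using IH S(3) by (simp add: sum.distrib)
    also have "\<dots> = t * card V"
      unfolding add_mult_distrib2[symmetric] using S finite_V
      by (metis card_Diff_subset card_mono finite_subset le_add_diff_inverse2)
    finally show ?thesis by (simp add: nbh_def)
  qed
qed

section \<open>Brooms\<close>

lemma rainbow_broom_copy:
  assumes G: "simple_graph G" and pc: "proper_edge_coloring G c" and t: "t \<ge> 3"
    and path: "{v, a} \<in> edges G" "{a, b} \<in> edges G" "{b, d} \<in> edges G" "distinct [v, a, b, d]"
      "c {v, a} \<noteq> c {b, d}"
    and X: "finite X" "card X = t - 3" "\<And>x. x \<in> X \<Longrightarrow> {v, x} \<in> edges G" "X \<inter> {a, b, d} = {}"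
      "\<And>x. x \<in> X \<Longrightarrow> c {v, x} \<noteq> c {a, b} \<and> c {v, x} \<noteq> c {b, d}"
  shows "\<exists>H. is_copy (broom t 3) G H \<and> rainbow c H"
proof -
  have vX: "v \<notin> X"
  proof
    assume "v \<in> X"
    then have "{v} \<in> edges G" using X(3)[of v] by simp
    then show False using G by (force simp: simple_graph_def)
  qed
  have "card {4..t} = card X" using X(2) t by simp
  then obtain g where g: "bij_betw g {4..t} X"
    using finite_same_card_bij[of "{4..t}" X] X(1) by auto
  \<comment> \<open>The handle runs backwards: its end vertex 3, which carries the bristles, becomes
    \<open>v\<close>.\<close>
  define f where "f i = (if i = 0 then d else if i = 1 then b else if i = 2 then a
    else if i = 3 then v else g i)" for i :: nat
  have f_low: "f 0 = d" "f 1 = b" "f (Suc 0) = b" "f 2 = a" "f 3 = v" by (simp_all add: f_def)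
  have f_high: "f i = g i" if "i \<ge> 4" for i using that by (simp add: f_def)
  have img: "f ` {4..t} = X"
    using g f_high by (auto simp: bij_betw_def image_def)
  have vs: "{0..t} = {0, 1, 2, 3} \<union> {4..t}" using t by auto
  have inj: "inj_on f {0..t}"
    unfolding vs
  proof (rule inj_on_Un[THEN iffD2], intro conjI)
    show "inj_on f {0, 1, 2, 3}" using path(4) f_low by (auto simp: inj_on_def)
    show "inj_on f {4..t}" using g f_high by (simp add: bij_betw_def inj_on_def)
    have "f ` {0, 1, 2, 3} = {d, b, a, v}" using f_low by auto
    then have "f ` {0, 1, 2, 3} \<inter> f ` {4..t} = {}" using vX X(4) img by auto
    moreover have "f ` ({0, 1, 2, 3} - {4..t}) \<inter> f ` ({4..t} - {0, 1, 2, 3}) \<subseteq>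
      f ` {0, 1, 2, 3} \<inter> f ` {4..t}" by (intro Int_mono image_mono Diff_subset)
    ultimately show "f ` ({0, 1, 2, 3} - {4..t}) \<inter> f ` ({4..t} - {0, 1, 2, 3}) = {}"
      by simp
  qed
  let ?E = "{{d, b}, {b, a}, {a, v}} \<union> (\<lambda>x. {v, x}) ` X"
  have broom_edges: "edges (broom t 3) = {{0, 1}, {1, 2}, {2, 3}} \<union> (\<lambda>j. {3, j}) ` {4..t}"
  proof -
    have "{{i, i + 1} |i. i < 3} = {{0, 1}, {1, 2}, {2, 3 :: nat}}"
      by (auto simp: less_Suc_eq numeral_3_eq_3 numeral_2_eq_2)
    moreover have "{{3, j} |j. 3 < j \<and> j \<le> t} = (\<lambda>j. {3, j}) ` {4..t}" by auto
    ultimately show ?thesis by (simp add: broom_def)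
  qed
  have E: "(\<lambda>e. f ` e) ` edges (broom t 3) = ?E"
    unfolding broom_edges img[symmetric] by (simp add: image_Un image_image f_low)
  define H where "H = \<lparr>verts = f ` {0..t}, edges = ?E\<rparr>"
  have EG: "?E \<subseteq> edges G" using path X(3) by (auto simp: insert_commute)
  have fv: "f ` {0..t} = {d, b, a, v} \<union> X" unfolding vs image_Un img by (simp add: f_low)
  have "subgraph H G"
    unfolding subgraph_def simple_graph_def
  proof (intro conjI ballI)
    show "finite (verts H)" by (simp add: H_def)
    show "edges H \<subseteq> edges G" using EG by (simp add: H_def)
    have "e \<subseteq> verts G" if "e \<in> edges G" for e using G that by (simp add: simple_graph_def)
    then show "verts H \<subseteq> verts G" using path X(3) by (auto simp: H_def fv)
    fix e assume e: "e \<in> edges H"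
    then show "e \<subseteq> verts H" by (auto simp: H_def fv)
    show "card e = 2" using e EG G by (auto simp: H_def simple_graph_def)
  qed
  moreover have "isomorphic (broom t 3) H"
    unfolding isomorphic_def
    using inj E by (intro exI[of _ f]) (simp add: H_def bij_betw_def broom_def)
  moreover have "rainbow c H"
  proof -
    have pr: "c e \<noteq> c e'" if "e \<in> ?E" "e' \<in> ?E" "e \<noteq> e'" "e \<inter> e' \<noteq> {}" for e e'
    proof -
      have "e \<in> edges G" "e' \<in> edges G" using EG that(1,2) by (simp_all only: subset_iff)
      then show ?thesis using pc that(3,4) unfolding proper_edge_coloring_def by metis
    qed
    \<comment> \<open>Incident edges differ by properness. The disjoint pairs of edges are
      \<open>v a\<close> with \<open>b d\<close>, and \<open>v x\<close> with \<open>a b\<close> or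
      \<open>b d\<close>; these are covered by assumption.\<close>
    have "inj_on c ?E"
    proof (rule inj_onI, rule ccontr)
      fix e e' assume e: "e \<in> ?E" "e' \<in> ?E" "c e = c e'" "e \<noteq> e'"
      then have disj: "e \<inter> e' = {}" using pr by blast
      have eqs: "c {d, b} = c {b, d}" "c {b, a} = c {a, b}" "c {a, v} = c {v, a}"
        by (simp_all add: insert_commute)
      show False
        using e(1,2)
        by (elim UnE insertE emptyE imageE) (use e(3,4) disj X(5) path(5) eqs in auto)
    qed
    then show ?thesis by (simp add: rainbow_def H_def)
  qed
  ultimately show ?thesis by (auto simp: is_copy_def)
qed

lemma card_edges_degree_sum:
  assumes G: "simple_graph G"
  shows "2 * card (edges G) \<le> (\<Sum>x\<in>verts G. card {y. {x, y} \<in> edges G})"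
proof -
  let ?A = "SIGMA x:verts G. {y. {x, y} \<in> edges G}"
  have fin: "finite (verts G)" "finite {y. {x, y} \<in> edges G}" for x
  proof -
    show V: "finite (verts G)" using G by (simp add: simple_graph_def)
    show "finite {y. {x, y} \<in> edges G}"
      by (rule finite_subset[OF _ V]) (use G in \<open>auto simp: simple_graph_def\<close>)
  qed
  have A: "(y, x) \<in> ?A \<and> x \<noteq> y" if "(x, y) \<in> ?A" for x y
    using that G by (force simp: simple_graph_def insert_commute)
  have finA: "finite ?A" using fin by (intro finite_SigmaI) auto
  \<comment> \<open>An edge is recovered from its two orientations by collecting their first
    components.\<close>
  have "edges G \<subseteq> (\<lambda>Z. fst ` Z) ` (\<lambda>p. {p, prod.swap p}) ` ?A"
  proof
    fix e assume e: "e \<in> edges G"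
    then obtain x y where xy: "e = {x, y}" using G by (auto simp: simple_graph_def card_2_iff)
    then have "(x, y) \<in> ?A" using e G by (auto simp: simple_graph_def)
    moreover have "e = fst ` {(x, y), prod.swap (x, y)}" using xy by auto
    ultimately show "e \<in> (\<lambda>Z. fst ` Z) ` (\<lambda>p. {p, prod.swap p}) ` ?A" by blast
  qed
  then have "card (edges G) \<le> card ((\<lambda>p. {p, prod.swap p}) ` ?A)"
    using finA by (meson card_image_le card_mono finite_imageI le_trans)
  moreover have "2 * card ((\<lambda>p. {p, prod.swap p}) ` ?A) = card ?A"
  proof (rule card_involution_pairs[OF finA])
    fix p assume "p \<in> ?A"
    then show "prod.swap p \<in> ?A \<and> prod.swap p \<noteq> p \<and> prod.swap (prod.swap p) = p"
      using A[of "fst p" "snd p"] by (cases p) auto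
  qed
  moreover have "card ?A = (\<Sum>x\<in>verts G. card {y. {x, y} \<in> edges G})"
    using fin by simp
  ultimately show ?thesis by simp
qed

lemma rainbow_broom_free_card_edges:
  assumes G: "simple_graph G" and free: "rainbow_free (broom t 3) G" and t: "t > 0" "4 dvd t"
  shows "2 * card (edges G) \<le> t * card (verts G)"
proof -
  obtain c where pc: "proper_edge_coloring G c" and nc: "\<nexists>H. is_copy (broom t 3) G H \<and> rainbow c H"
    using free by (auto simp: rainbow_free_def)
  have t4: "t \<ge> 4" using t dvd_imp_le by blast
  have edge: "x \<in> verts G \<and> y \<in> verts G \<and> x \<noteq> y" if "{x, y} \<in> edges G" for x y
    using G that by (force simp: simple_graph_def)
  have "broom_free_coloring (verts G) (\<lambda>x y. {x, y} \<in> edges G) (\<lambda>x y. c {x, y}) t"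
  proof
    show "finite (verts G)" using G by (simp add: simple_graph_def)
    show "x \<in> verts G \<and> y \<in> verts G \<and> x \<noteq> y" if "{x, y} \<in> edges G" for x y using edge that .
    show "{y, x} \<in> edges G" if "{x, y} \<in> edges G" for x y using that by (simp add: insert_commute)
    show "c {x, y} = c {y, x}" for x y by (simp add: insert_commute)
    show "y = z" if "{x, y} \<in> edges G" "{x, z} \<in> edges G" "c {x, y} = c {x, z}" for x y z
    proof (rule ccontr)
      assume "y \<noteq> z"
      then have "{x, y} \<noteq> {x, z}" "{x, y} \<inter> {x, z} \<noteq> {}" by (auto simp: doubleton_eq_iff)
      then show False using pc that unfolding proper_edge_coloring_def by metis
    qed
    show "card {x. {v, x} \<in> edges G \<and> x \<notin> {a, b, d} \<and> c {v, x} \<notin> {c {a, b}, c {b, d}}} < t - 3"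
      (is "card ?G < _")
      if "{v, a} \<in> edges G" "{a, b} \<in> edges G" "{b, d} \<in> edges G" "distinct [v, a, b, d]"
        "c {v, a} \<noteq> c {b, d}" for v a b d
    proof (rule ccontr)
      assume "\<not> ?thesis"
      then have "t - 3 \<le> card ?G" by (simp only: not_less)
      then obtain X where X: "X \<subseteq> ?G" "card X = t - 3" "finite X"
        by (rule obtain_subset_with_card_n)
      then have "\<exists>H. is_copy (broom t 3) G H \<and> rainbow c H"
        using t4 by (intro rainbow_broom_copy[OF G pc _ that X(3,2)]) auto
      then show False using nc by blast
    qed
  qed (use t in auto)
  then show ?thesis by (rule le_trans[OF card_edges_degree_sum[OF G] broom_free_degree_sum])
qed

theorem theorem1p6:
  fixes t :: nat
  assumes "t > 0" and "t mod 4 = 0"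
  shows "\<exists>C::real. \<forall>n. real (ex_star n (broom t 3)) \<le> real t / 2 * real n + C"
proof (intro exI[of _ 0] allI)
  fix n
  let ?S = "{card (edges G) | G :: nat ugraph.
    simple_graph G \<and> card (verts G) = n \<and> rainbow_free (broom t 3) G}"
  \<comment> \<open>Divisibility gives \<open>t >= 4\<close>, so the broom has a bristle, and
    \<open>ex_star_well_defined\<close> makes \<open>ex_star\<close> a genuine maximum.\<close>
  have "{3, 4} \<in> edges (broom t 3)" "4 dvd t"
    using assms by (auto simp: broom_def intro!: exI[of _ "4::nat"] dvd_imp_le)
  then have ne: "edges (broom t 3) \<noteq> {}" by blast
  have "ex_star n (broom t 3) \<in> ?S"
    unfolding ex_star_def using ex_star_well_defined[OF ne, of n] by (rule Max_in)
  then obtain G :: "nat ugraph" where G: "ex_star n (broom t 3) = card (edges G)"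
    "simple_graph G" "card (verts G) = n" "rainbow_free (broom t 3) G"
    by blast
  have "2 * card (edges G) \<le> t * n"
    using rainbow_broom_free_card_edges[OF G(2,4) assms(1) \<open>4 dvd t\<close>] G(3) by simp
  then have "2 * real (card (edges G)) \<le> real t * real n"
    by (metis of_nat_le_iff of_nat_mult of_nat_numeral)
  then show "real (ex_star n (broom t 3)) \<le> real t / 2 * real n + 0" using G(1) by simp
qed

end
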